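(* Let $A$ be a residuated lattice and let $\tilde{A}$ be the strongly co-Stone hull of $A$. Then $\tilde{A}$ is a strongly co-Stone residuated lattice.
   Context: A residuated lattice is an algebra $(A,\vee,\wedge,\odot,\rightarrow,0,1)$ such that $(A,\vee,\wedge,0,1)$ is a bounded lattice, $(A,\odot,1)$ is a commutative monoid, and $a\leq b\rightarrow c$ iff $a\odot b\leq c$ for all $a,b,c\in A$. A filter of $A$ is a non-empty upward closed subset closed under $\odot$; $\langle x\rangle$ is the filter generated by $x$. $B(A)$ is the Boolean algebra of complemented elements of $A$. For $X\subseteq A$, $X^{\top}=\{a\in A\mid a\vee x=1\text{ for all }x\in X\}$, which is a filter. $A$ is strongly co-Stone iff for all $X\subseteq A$ there exists $e\in B(A)$ with $X^{\top}=\langle e\rangle$. For a filter $F$, $A/F$ is the quotient by the congruence $a\equiv b$ iff $(a\rightarrow b)\wedge(b\rightarrow a)\in F$, and $a/F$ is the class of $a$. Construction of $\tilde{A}$: $\mathrm{CoAnn}(A)=\{X^{\top}\mid X\subseteq A\}$ is a complete Boolean algebra under inclusion, with meet $\cap$, complement $F\mapsto F^{\top}$, least element $\{1\}$, greatest element $A$, and join $\bigvee^{\top}_{t}F_t=(\bigcap_t F_t^{\top})^{\top}$. $\Pi(A)$ is the set of finite partitions of $\mathrm{CoAnn}(A)$, i.e. finite sets $\mathcal{C}$ of elements of $\mathrm{CoAnn}(A)\setminus\{\{1\}\}$, pairwise with intersection $\{1\}$, and with join $A$ (the empty partition occurs only when $A$ is trivial). Order: $\mathcal{C}\leq\mathcal{D}$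 iff $\mathcal{D}$ refines $\mathcal{C}$, i.e. every $D\in\mathcal{D}$ is contained in a (necessarily unique) $C\in\mathcal{C}$; $\Pi(A)$ is directed. Put $A_{\mathcal{C}}=\prod_{C\in\mathcal{C}}A/C^{\top}$, and for $\mathcal{C}\leq\mathcal{D}$ let $\mathcal{P}_{\mathcal{C}\mathcal{D}}:A_{\mathcal{C}}\to A_{\mathcal{D}}$ send $(a_C/C^{\top})_{C\in\mathcal{C}}$ to $(b_D/D^{\top})_{D\in\mathcal{D}}$ with $b_D=a_C$ for the unique $C\in\mathcal{C}$ with $D\subseteq C$. These are injective morphisms forming an inductive system, and $\tilde{A}=\varinjlim_{\mathcal{C}\in\Pi(A)}A_{\mathcal{C}}$ (direct limit in the category of residuated lattices). *)

theory Defs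
  imports "HOL-Algebra.Group"
begin

section \<open>Residuated lattices\<close>

text \<open>The multiplication and the unit are those of the HOL-Algebra monoid record; the unit is at
  the same time the top element of the lattice.\<close>

record 'a reslat = "'a monoid" +
  rl_join :: "'a \<Rightarrow> 'a \<Rightarrow> 'a" (infixl "\<^bold>\<or>\<index>" 65)
  rl_meet :: "'a \<Rightarrow> 'a \<Rightarrow> 'a" (infixl "\<^bold>\<and>\<index>" 65)
  rl_imp  :: "'a \<Rightarrow> 'a \<Rightarrow> 'a" (infixr "\<^bold>\<rightarrow>\<index>" 60)
  rl_zero :: 'a ("\<zero>\<index>")

definition rl_le :: "('a, 'b) reslat_scheme \<Rightarrow> 'a \<Rightarrow> 'a \<Rightarrow> bool" (infix "\<^bold>\<le>\<index>" 50)
  where "x \<^bold>\<le>\<^bsub>A\<^esub> y \<longleftrightarrow> x \<^bold>\<and>\<^bsub>A\<^esub> y = x"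

locale residuated_lattice = comm_monoid A for A :: "('a, 'b) reslat_scheme" (structure) +
  assumes join_closed: "x \<in> carrier A \<Longrightarrow> y \<in> carrier A \<Longrightarrow> x \<^bold>\<or> y \<in> carrier A"
    and meet_closed: "x \<in> carrier A \<Longrightarrow> y \<in> carrier A \<Longrightarrow> x \<^bold>\<and> y \<in> carrier A"
    and imp_closed: "x \<in> carrier A \<Longrightarrow> y \<in> carrier A \<Longrightarrow> x \<^bold>\<rightarrow> y \<in> carrier A"
    and zero_closed: "\<zero> \<in> carrier A"
    and join_comm: "x \<in> carrier A \<Longrightarrow> y \<in> carrier A \<Longrightarrow> x \<^bold>\<or> y = y \<^bold>\<or> x"
    and meet_comm: "x \<in> carrier A \<Longrightarrow> y \<in> carrier A \<Longrightarrow> x \<^bold>\<and> y = y \<^bold>\<and> x"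
    and join_assoc: "x \<in> carrier A \<Longrightarrow> y \<in> carrier A \<Longrightarrow> z \<in> carrier A \<Longrightarrow>
      (x \<^bold>\<or> y) \<^bold>\<or> z = x \<^bold>\<or> (y \<^bold>\<or> z)"
    and meet_assoc: "x \<in> carrier A \<Longrightarrow> y \<in> carrier A \<Longrightarrow> z \<in> carrier A \<Longrightarrow>
      (x \<^bold>\<and> y) \<^bold>\<and> z = x \<^bold>\<and> (y \<^bold>\<and> z)"
    and join_absorb: "x \<in> carrier A \<Longrightarrow> y \<in> carrier A \<Longrightarrow> x \<^bold>\<or> (x \<^bold>\<and> y) = x"
    and meet_absorb: "x \<in> carrier A \<Longrightarrow> y \<in> carrier A \<Longrightarrow> x \<^bold>\<and> (x \<^bold>\<or> y) = x"
    and zero_least: "x \<in> carrier A \<Longrightarrow> \<zero> \<^bold>\<le> x"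
    and one_greatest: "x \<in> carrier A \<Longrightarrow> x \<^bold>\<le> \<one>"
    and residuation: "x \<in> carrier A \<Longrightarrow> y \<in> carrier A \<Longrightarrow> z \<in> carrier A \<Longrightarrow>
      x \<^bold>\<le> y \<^bold>\<rightarrow> z \<longleftrightarrow> x \<otimes> y \<^bold>\<le> z"


section \<open>Filters, Boolean center and co-annihilators\<close>

definition rl_filter :: "('a, 'b) reslat_scheme \<Rightarrow> 'a set \<Rightarrow> bool"
  where "rl_filter A F \<longleftrightarrow> F \<subseteq> carrier A \<and> F \<noteq> {} \<and>
    (\<forall>x\<in>F. \<forall>y\<in>carrier A. x \<^bold>\<le>\<^bsub>A\<^esub> y \<longrightarrow> y \<in> F) \<and>
    (\<forall>x\<in>F. \<forall>y\<in>F. x \<otimes>\<^bsub>A\<^esub> y \<in> F)"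

definition principal_filter :: "('a, 'b) reslat_scheme \<Rightarrow> 'a \<Rightarrow> 'a set"
  where "principal_filter A x = \<Inter> {F. rl_filter A F \<and> x \<in> F}"

definition boolean_center :: "('a, 'b) reslat_scheme \<Rightarrow> 'a set"
  where "boolean_center A =
    {e \<in> carrier A. \<exists>f\<in>carrier A. e \<^bold>\<or>\<^bsub>A\<^esub> f = \<one>\<^bsub>A\<^esub> \<and> e \<^bold>\<and>\<^bsub>A\<^esub> f = \<zero>\<^bsub>A\<^esub>}"

definition coann :: "('a, 'b) reslat_scheme \<Rightarrow> 'a set \<Rightarrow> 'a set"
  where "coann A X = {a \<in> carrier A. \<forall>x\<in>X. a \<^bold>\<or>\<^bsub>A\<^esub> x = \<one>\<^bsub>A\<^esub>}"

definition CoAnn :: "('a, 'b) reslat_scheme \<Rightarrow> 'a set set"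
  where "CoAnn A = {coann A X | X. X \<subseteq> carrier A}"

text \<open>The intersection is taken inside the carrier, so that the join of the empty family is the
  least co-annihilator, the co-annihilator of the whole carrier.\<close>

definition CoAnn_join :: "('a, 'b) reslat_scheme \<Rightarrow> 'a set set \<Rightarrow> 'a set"
  where "CoAnn_join A \<F> = coann A (carrier A \<inter> (\<Inter>F\<in>\<F>. coann A F))"

locale strongly_co_Stone = residuated_lattice +
  assumes coann_principal:
    "X \<subseteq> carrier A \<Longrightarrow> \<exists>e\<in>boolean_center A. coann A X = principal_filter A e"


section \<open>Quotients, products and direct limits\<close>

definition filter_cong :: "('a, 'b) reslat_scheme \<Rightarrow> 'a set \<Rightarrow> ('a \<times> 'a) set"
  where "filter_cong A F =
    {(a, b) \<in> carrier A \<times> carrier A. (a \<^bold>\<rightarrow>\<^bsub>A\<^esub> b) \<^bold>\<and>\<^bsub>A\<^esub> (b \<^bold>\<rightarrow>\<^bsub>A\<^esub> a) \<in> F}"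

definition rl_class :: "('a, 'b) reslat_scheme \<Rightarrow> 'a set \<Rightarrow> 'a \<Rightarrow> 'a set"
  where "rl_class A F a = filter_cong A F `` {a}"

definition quot_op ::
  "('a, 'b) reslat_scheme \<Rightarrow> 'a set \<Rightarrow> ('a \<Rightarrow> 'a \<Rightarrow> 'a) \<Rightarrow> 'a set \<Rightarrow> 'a set \<Rightarrow> 'a set"
  where "quot_op A F g U V = (\<Union>a\<in>U. \<Union>b\<in>V. rl_class A F (g a b))"

definition rl_quotient :: "('a, 'b) reslat_scheme \<Rightarrow> 'a set \<Rightarrow> 'a set reslat"
  where "rl_quotient A F =
    \<lparr>carrier = carrier A // filter_cong A F,
     mult = quot_op A F (mult A),
     one = rl_class A F \<one>\<^bsub>A\<^esub>,
     rl_join = quot_op A F (rl_join A),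
     rl_meet = quot_op A F (rl_meet A),
     rl_imp = quot_op A F (rl_imp A),
     rl_zero = rl_class A F \<zero>\<^bsub>A\<^esub>\<rparr>"

definition rl_product :: "'i set \<Rightarrow> ('i \<Rightarrow> ('a, 'b) reslat_scheme) \<Rightarrow> ('i \<Rightarrow> 'a) reslat"
  where "rl_product I L =
    \<lparr>carrier = (\<Pi>\<^sub>E i\<in>I. carrier (L i)),
     mult = (\<lambda>u v. \<lambda>i\<in>I. u i \<otimes>\<^bsub>L i\<^esub> v i),
     one = (\<lambda>i\<in>I. \<one>\<^bsub>L i\<^esub>),
     rl_join = (\<lambda>u v. \<lambda>i\<in>I. u i \<^bold>\<or>\<^bsub>L i\<^esub> v i),
     rl_meet = (\<lambda>u v. \<lambda>i\<in>I. u i \<^bold>\<and>\<^bsub>L i\<^esub> v i),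
     rl_imp = (\<lambda>u v. \<lambda>i\<in>I. u i \<^bold>\<rightarrow>\<^bsub>L i\<^esub> v i),
     rl_zero = (\<lambda>i\<in>I. \<zero>\<^bsub>L i\<^esub>)\<rparr>"

text \<open>The direct limit of an inductive system \<open>(L i, f i j)\<close> over a directed preordered set
  \<open>(I, leq)\<close>: the disjoint union of the carriers modulo eventual equality. An operation is computed
  at any common upper bound of the indices of two representatives; when the system is directed and
  the \<open>f i j\<close> are compatible morphisms, all classes in the unions below coincide.\<close>

definition dirlim_rel ::
  "'i set \<Rightarrow> ('i \<Rightarrow> 'i \<Rightarrow> bool) \<Rightarrow> ('i \<Rightarrow> ('a, 'b) reslat_scheme) \<Rightarrow> ('i \<Rightarrow> 'i \<Rightarrow> 'a \<Rightarrow> 'a)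
    \<Rightarrow> (('i \<times> 'a) \<times> ('i \<times> 'a)) set"
  where "dirlim_rel I leq L f =
    {((i, x), (j, y)). i \<in> I \<and> x \<in> carrier (L i) \<and> j \<in> I \<and> y \<in> carrier (L j) \<and>
      (\<exists>k\<in>I. leq i k \<and> leq j k \<and> f i k x = f j k y)}"

definition dirlim_op ::
  "'i set \<Rightarrow> ('i \<Rightarrow> 'i \<Rightarrow> bool) \<Rightarrow> ('i \<Rightarrow> ('a, 'b) reslat_scheme) \<Rightarrow> ('i \<Rightarrow> 'i \<Rightarrow> 'a \<Rightarrow> 'a)
    \<Rightarrow> (('a, 'b) reslat_scheme \<Rightarrow> 'a \<Rightarrow> 'a \<Rightarrow> 'a)
    \<Rightarrow> ('i \<times> 'a) set \<Rightarrow> ('i \<times> 'a) set \<Rightarrow> ('i \<times> 'a) set"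
  where "dirlim_op I leq L f g U V =
    (\<Union>(i, x)\<in>U. \<Union>(j, y)\<in>V. \<Union>k\<in>{k \<in> I. leq i k \<and> leq j k}.
      dirlim_rel I leq L f `` {(k, g (L k) (f i k x) (f j k y))})"

definition dirlim ::
  "'i set \<Rightarrow> ('i \<Rightarrow> 'i \<Rightarrow> bool) \<Rightarrow> ('i \<Rightarrow> ('a, 'b) reslat_scheme) \<Rightarrow> ('i \<Rightarrow> 'i \<Rightarrow> 'a \<Rightarrow> 'a)
    \<Rightarrow> ('i \<times> 'a) set reslat"
  where "dirlim I leq L f =
    \<lparr>carrier = (SIGMA i:I. carrier (L i)) // dirlim_rel I leq L f,
     mult = dirlim_op I leq L f mult,
     one = (\<Union>i\<in>I. dirlim_rel I leq L f `` {(i, \<one>\<^bsub>L i\<^esub>)}),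
     rl_join = dirlim_op I leq L f rl_join,
     rl_meet = dirlim_op I leq L f rl_meet,
     rl_imp = dirlim_op I leq L f rl_imp,
     rl_zero = (\<Union>i\<in>I. dirlim_rel I leq L f `` {(i, \<zero>\<^bsub>L i\<^esub>)})\<rparr>"


section \<open>The strongly co-Stone hull\<close>

definition finite_partitions :: "('a, 'b) reslat_scheme \<Rightarrow> 'a set set set"
  where "finite_partitions A =
    {\<C>. finite \<C> \<and> \<C> \<subseteq> CoAnn A - {{\<one>\<^bsub>A\<^esub>}} \<and>
      (\<forall>C\<in>\<C>. \<forall>D\<in>\<C>. C \<noteq> D \<longrightarrow> C \<inter> D = {\<one>\<^bsub>A\<^esub>}) \<and> CoAnn_join A \<C> = carrier A}"

definition refined_by :: "'a set set \<Rightarrow> 'a set set \<Rightarrow> bool"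
  where "refined_by \<C> \<D> \<longleftrightarrow> (\<forall>D\<in>\<D>. \<exists>C\<in>\<C>. D \<subseteq> C)"

definition partition_product ::
  "('a, 'b) reslat_scheme \<Rightarrow> 'a set set \<Rightarrow> ('a set \<Rightarrow> 'a set) reslat"
  where "partition_product A \<C> = rl_product \<C> (\<lambda>C. rl_quotient A (coann A C))"

text \<open>In the component at \<open>D\<close>, the union runs over the representatives \<open>a\<close> of the class of \<open>u\<close> at
  the unique \<open>C\<close> above \<open>D\<close>; they are all congruent modulo the larger filter \<open>coann A D\<close>.\<close>

definition partition_map ::
  "('a, 'b) reslat_scheme \<Rightarrow> 'a set set \<Rightarrow> 'a set set \<Rightarrow> ('a set \<Rightarrow> 'a set) \<Rightarrow> 'a set \<Rightarrow> 'a set"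
  where "partition_map A \<C> \<D> u =
    (\<lambda>D\<in>\<D>. \<Union>a\<in>u (THE C. C \<in> \<C> \<and> D \<subseteq> C). rl_class A (coann A D) a)"

definition strongly_co_Stone_hull ::
  "('a, 'b) reslat_scheme \<Rightarrow> ('a set set \<times> ('a set \<Rightarrow> 'a set)) set reslat"
  where "strongly_co_Stone_hull A =
    dirlim (finite_partitions A) refined_by (partition_product A) (partition_map A)"

end

(*
  Residuated lattices form a variety, so the hull is a residuated lattice, being a direct limit of
  products of quotients.

  To an element x of the hull attach its trace G(x), the set of all t in A whose image in the hull
  joins with x to 1. If x is given by (a_C) over a partition, then G(x) is the co-annihilator of all
  a_C \<or> c with c in C, and x \<or> y = 1 iff the co-annihilator of G(x) is contained in G(y). Hence the
  co-annihilator of a set X in the hull depends only on the intersection G of the traces of its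
  elements. This G is again a co-annihilator of A, and it is the trace of the element f given by
  1 on G and 0 on the co-annihilator of G. So X and {f} have the same co-annihilator, and this is the
  principal filter of the complement of f.
*)

theory Submission
  imports Defs
begin

section \<open>Arithmetic of residuated lattices\<close>

text \<open>The lattice reduct need not be distributive. What replaces distributivity is that
  \<open>x \<or> z = \<one>\<close> and \<open>y \<or> z = \<one>\<close> give
  \<open>(x \<otimes> y) \<or> z = \<one>\<close>, a consequence of \<otimes> distributing over
  joins; it makes every co-annihilator a filter. The obstacle is that the elements of an infinite
  set in the hull may live over partitions without a common finite refinement, so its co-annihilator
  cannot be computed inside one product. Traces move the question into \<open>CoAnn A\<close>, which
  is closed under arbitrary intersections, and the resulting co-annihilator again needs only a
  partition with at most two blocks. Two properties of partitions are used throughout. Members of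
  distinct blocks join to \<one>, so mixed terms vanish. An element that joins to \<one> with every
  member of every block is itself \<one>, which brings information from a fine partition back to a
  coarse one. Since a class modulo \<open>coann A C\<close> is the unit iff its representative joins
  to \<one> with all of \<open>C\<close>, every equation with the unit of the hull becomes a
  statement about joins in \<open>A\<close>.\<close>

context residuated_lattice
begin

section \<open>Order and bounds of the underlying lattice\<close>

lemma join_idem: "x \<in> carrier A \<Longrightarrow> x \<^bold>\<or> x = x"
  by (metis join_absorb meet_absorb join_closed)

lemma meet_idem: "x \<in> carrier A \<Longrightarrow> x \<^bold>\<and> x = x"
  by (metis join_absorb meet_absorb meet_closed)

lemma le_iff_join: "x \<in> carrier A \<Longrightarrow> y \<in> carrier A \<Longrightarrow> x \<^bold>\<le> y \<longleftrightarrow> x \<^bold>\<or> y = y"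
  unfolding rl_le_def by (metis join_absorb join_comm meet_absorb meet_comm)

lemma le_refl: "x \<in> carrier A \<Longrightarrow> x \<^bold>\<le> x"
  by (simp add: rl_le_def meet_idem)

lemma le_antisym: "x \<in> carrier A \<Longrightarrow> y \<in> carrier A \<Longrightarrow> x \<^bold>\<le> y \<Longrightarrow> y \<^bold>\<le> x \<Longrightarrow> x = y"
  unfolding rl_le_def by (metis meet_comm)

lemma le_trans:
  "x \<in> carrier A \<Longrightarrow> y \<in> carrier A \<Longrightarrow> z \<in> carrier A \<Longrightarrow> x \<^bold>\<le> y \<Longrightarrow> y \<^bold>\<le> z \<Longrightarrow> x \<^bold>\<le> z"
  unfolding rl_le_def by (metis meet_assoc)

lemma le_join1: "x \<in> carrier A \<Longrightarrow> y \<in> carrier A \<Longrightarrow> x \<^bold>\<le> x \<^bold>\<or> y"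
  by (simp add: rl_le_def meet_absorb)

lemma le_join2: "x \<in> carrier A \<Longrightarrow> y \<in> carrier A \<Longrightarrow> y \<^bold>\<le> x \<^bold>\<or> y"
  by (metis le_join1 join_comm)

lemma meet_le1: "x \<in> carrier A \<Longrightarrow> y \<in> carrier A \<Longrightarrow> x \<^bold>\<and> y \<^bold>\<le> x"
  by (metis le_iff_join join_absorb join_comm meet_closed)

lemma meet_le2: "x \<in> carrier A \<Longrightarrow> y \<in> carrier A \<Longrightarrow> x \<^bold>\<and> y \<^bold>\<le> y"
  by (metis meet_le1 meet_comm)

lemma join_least:
  "x \<in> carrier A \<Longrightarrow> y \<in> carrier A \<Longrightarrow> z \<in> carrier A \<Longrightarrow> x \<^bold>\<le> z \<Longrightarrow> y \<^bold>\<le> z \<Longrightarrow> x \<^bold>\<or> y \<^bold>\<le> z"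
  by (simp add: le_iff_join join_closed join_assoc)

lemma meet_greatest:
  "x \<in> carrier A \<Longrightarrow> y \<in> carrier A \<Longrightarrow> z \<in> carrier A \<Longrightarrow> z \<^bold>\<le> x \<Longrightarrow> z \<^bold>\<le> y \<Longrightarrow> z \<^bold>\<le> x \<^bold>\<and> y"
  by (metis rl_le_def meet_assoc)

lemma one_le_iff: "x \<in> carrier A \<Longrightarrow> \<one> \<^bold>\<le> x \<longleftrightarrow> x = \<one>"
  using le_antisym le_refl one_greatest one_closed by blast

lemma join_one_left: "x \<in> carrier A \<Longrightarrow> \<one> \<^bold>\<or> x = \<one>"
  by (metis le_join1 one_le_iff one_closed join_closed)

lemma join_one_right: "x \<in> carrier A \<Longrightarrow> x \<^bold>\<or> \<one> = \<one>"
  by (metis join_one_left join_comm one_closed)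

lemma join_zero_left: "x \<in> carrier A \<Longrightarrow> \<zero> \<^bold>\<or> x = x"
  using le_iff_join zero_least zero_closed by blast

lemma join_zero_right: "x \<in> carrier A \<Longrightarrow> x \<^bold>\<or> \<zero> = x"
  by (metis join_zero_left join_comm zero_closed)

lemma meet_zero_left: "x \<in> carrier A \<Longrightarrow> \<zero> \<^bold>\<and> x = \<zero>"
  using zero_least by (simp add: rl_le_def)

lemma meet_zero_right: "x \<in> carrier A \<Longrightarrow> x \<^bold>\<and> \<zero> = \<zero>"
  by (metis meet_zero_left meet_comm zero_closed)

lemma join_left_comm:
  "x \<in> carrier A \<Longrightarrow> y \<in> carrier A \<Longrightarrow> z \<in> carrier A \<Longrightarrow> x \<^bold>\<or> (y \<^bold>\<or> z) = y \<^bold>\<or> (x \<^bold>\<or> z)"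
  by (metis join_assoc join_comm)

lemma join_left_idem: "x \<in> carrier A \<Longrightarrow> y \<in> carrier A \<Longrightarrow> x \<^bold>\<or> (x \<^bold>\<or> y) = x \<^bold>\<or> y"
  by (metis join_assoc join_idem)

lemmas join_ac = join_assoc join_comm join_left_comm join_left_idem join_idem

lemma join_eq_one_mono:
  assumes "x \<in> carrier A" "y \<in> carrier A" "z \<in> carrier A" "x \<^bold>\<le> y" "x \<^bold>\<or> z = \<one>"
  shows "y \<^bold>\<or> z = \<one>"
  using assms by (metis join_assoc join_comm join_one_right le_iff_join)

section \<open>Multiplication, residuation and joins\<close>

lemma imp_mp: "x \<in> carrier A \<Longrightarrow> y \<in> carrier A \<Longrightarrow> (x \<^bold>\<rightarrow> y) \<otimes> x \<^bold>\<le> y"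
  using residuation[of "x \<^bold>\<rightarrow> y" x y] by (simp add: imp_closed le_refl)

lemma mult_mono_left:
  assumes "x \<in> carrier A" "y \<in> carrier A" "z \<in> carrier A" "x \<^bold>\<le> y"
  shows "x \<otimes> z \<^bold>\<le> y \<otimes> z"
proof -
  have "y \<^bold>\<le> z \<^bold>\<rightarrow> y \<otimes> z"
    using assms by (simp add: residuation le_refl)
  then have "x \<^bold>\<le> z \<^bold>\<rightarrow> y \<otimes> z"
    using assms le_trans imp_closed m_closed by meson
  then show ?thesis
    using assms by (simp add: residuation)
qed

lemma mult_mono_right:
  "x \<in> carrier A \<Longrightarrow> y \<in> carrier A \<Longrightarrow> z \<in> carrier A \<Longrightarrow> x \<^bold>\<le> y \<Longrightarrow> z \<otimes> x \<^bold>\<le> z \<otimes> y"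
  by (simp add: m_comm[of z] mult_mono_left)

lemma mult_le1: "x \<in> carrier A \<Longrightarrow> y \<in> carrier A \<Longrightarrow> x \<otimes> y \<^bold>\<le> x"
  using mult_mono_right[of y \<one> x] one_greatest by simp

lemma mult_le2: "x \<in> carrier A \<Longrightarrow> y \<in> carrier A \<Longrightarrow> x \<otimes> y \<^bold>\<le> y"
  by (metis mult_le1 m_comm)

text \<open>Multiplication by \<open>z\<close> is left adjoint to \<open>z \<rightarrow> _\<close>,
  hence preserves joins.\<close>

lemma join_mult_distrib:
  assumes "x \<in> carrier A" "y \<in> carrier A" "z \<in> carrier A"
  shows "(x \<^bold>\<or> y) \<otimes> z = (x \<otimes> z) \<^bold>\<or> (y \<otimes> z)"
proof (rule le_antisym)
  have "x \<^bold>\<or> y \<^bold>\<le> z \<^bold>\<rightarrow> ((x \<otimes> z) \<^bold>\<or> (y \<otimes> z))"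
    using assms
    by (intro join_least) (simp_all add: residuation le_join1 le_join2 join_closed imp_closed)
  then show "(x \<^bold>\<or> y) \<otimes> z \<^bold>\<le> (x \<otimes> z) \<^bold>\<or> (y \<otimes> z)"
    using assms by (simp add: residuation join_closed)
  show "(x \<otimes> z) \<^bold>\<or> (y \<otimes> z) \<^bold>\<le> (x \<^bold>\<or> y) \<otimes> z"
    using assms by (intro join_least mult_mono_left) (simp_all add: le_join1 le_join2 join_closed)
qed (use assms in \<open>simp_all add: join_closed\<close>)

lemma mult_join_distrib:
  "x \<in> carrier A \<Longrightarrow> y \<in> carrier A \<Longrightarrow> z \<in> carrier A \<Longrightarrow>
    z \<otimes> (x \<^bold>\<or> y) = (z \<otimes> x) \<^bold>\<or> (z \<otimes> y)"
  by (simp add: m_comm[of z] join_mult_distrib join_closed)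

lemma join_mono:
  assumes "x \<in> carrier A" "y \<in> carrier A" "x' \<in> carrier A" "y' \<in> carrier A" "x \<^bold>\<le> x'" "y \<^bold>\<le> y'"
  shows "x \<^bold>\<or> y \<^bold>\<le> x' \<^bold>\<or> y'"
  using assms by (meson join_least le_trans le_join1 le_join2 join_closed)

text \<open>Expanding \<open>(x \<or> z) \<otimes> (y \<or> z)\<close> leaves
  \<open>x \<otimes> y\<close> and terms below \<open>z\<close>. This stands in for lattice
  distributivity and gives closure of co-annihilators under \<otimes>.\<close>

lemma mult_join_eq_one:
  assumes "x \<in> carrier A" "y \<in> carrier A" "z \<in> carrier A" "x \<^bold>\<or> z = \<one>" "y \<^bold>\<or> z = \<one>"
  shows "(x \<otimes> y) \<^bold>\<or> z = \<one>"
proof -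
  have "\<one> = (x \<^bold>\<or> z) \<otimes> (y \<^bold>\<or> z)"
    using assms by simp
  also have "\<dots> = (x \<otimes> (y \<^bold>\<or> z)) \<^bold>\<or> (z \<otimes> (y \<^bold>\<or> z))"
    using assms(1-3) by (simp only: join_mult_distrib join_closed)
  also have "\<dots> = ((x \<otimes> y) \<^bold>\<or> (x \<otimes> z)) \<^bold>\<or> (z \<otimes> (y \<^bold>\<or> z))"
    using assms(1-3) by (simp only: mult_join_distrib)
  also have "\<dots> \<^bold>\<le> ((x \<otimes> y) \<^bold>\<or> z) \<^bold>\<or> z"
    using assms by (intro join_mono le_refl mult_le1 mult_le2) (simp_all add: join_closed)
  finally show ?thesis
    using assms by (simp add: join_ac join_closed one_le_iff)
qed

lemma residuation':
  "x \<in> carrier A \<Longrightarrow> y \<in> carrier A \<Longrightarrow> z \<in> carrier A \<Longrightarrow> x \<otimes> y \<^bold>\<le> z \<Longrightarrow> x \<^bold>\<le> y \<^bold>\<rightarrow> z"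
  by (simp add: residuation)

lemma imp_one_iff: "x \<in> carrier A \<Longrightarrow> y \<in> carrier A \<Longrightarrow> x \<^bold>\<rightarrow> y = \<one> \<longleftrightarrow> x \<^bold>\<le> y"
  using residuation[of \<one> x y] by (simp add: one_le_iff imp_closed)

lemma imp_self: "x \<in> carrier A \<Longrightarrow> x \<^bold>\<rightarrow> x = \<one>"
  by (simp add: imp_one_iff le_refl)

lemma one_imp: "x \<in> carrier A \<Longrightarrow> \<one> \<^bold>\<rightarrow> x = x"
  by (intro le_antisym) (use imp_mp[of \<one> x] in \<open>simp_all add: residuation imp_closed le_refl\<close>)

section \<open>Inequalities between implications that make filter congruences transitive and
  compatible\<close>

lemma imp_trans_le:
  assumes "x \<in> carrier A" "y \<in> carrier A" "z \<in> carrier A"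
  shows "(x \<^bold>\<rightarrow> y) \<otimes> (y \<^bold>\<rightarrow> z) \<^bold>\<le> x \<^bold>\<rightarrow> z"
proof (rule residuation')
  have "((x \<^bold>\<rightarrow> y) \<otimes> (y \<^bold>\<rightarrow> z)) \<otimes> x = (y \<^bold>\<rightarrow> z) \<otimes> ((x \<^bold>\<rightarrow> y) \<otimes> x)"
    using assms by (simp add: m_ac imp_closed)
  also have "\<dots> \<^bold>\<le> (y \<^bold>\<rightarrow> z) \<otimes> y"
    using assms by (intro mult_mono_right imp_mp) (simp_all add: imp_closed)
  finally have "((x \<^bold>\<rightarrow> y) \<otimes> (y \<^bold>\<rightarrow> z)) \<otimes> x \<^bold>\<le> (y \<^bold>\<rightarrow> z) \<otimes> y" .
  moreover have "(y \<^bold>\<rightarrow> z) \<otimes> y \<^bold>\<le> z"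
    using assms by (intro imp_mp)
  ultimately show "((x \<^bold>\<rightarrow> y) \<otimes> (y \<^bold>\<rightarrow> z)) \<otimes> x \<^bold>\<le> z"
    using assms by (meson le_trans imp_closed m_closed)
qed (use assms in \<open>simp_all add: imp_closed\<close>)

text \<open>This and the next four lemmas cover one translation each: if
  \<open>x \<rightarrow> y\<close> lies in a filter, upward closure puts the implication between the
  translated elements there as well.\<close>

lemma imp_le_mult_imp:
  assumes "x \<in> carrier A" "y \<in> carrier A" "z \<in> carrier A"
  shows "x \<^bold>\<rightarrow> y \<^bold>\<le> x \<otimes> z \<^bold>\<rightarrow> y \<otimes> z"
proof (rule residuation')
  show "(x \<^bold>\<rightarrow> y) \<otimes> (x \<otimes> z) \<^bold>\<le> y \<otimes> z"
    using assms mult_mono_left[OF _ _ _ imp_mp, of x y z] by (simp add: m_assoc imp_closed)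
qed (use assms in \<open>simp_all add: imp_closed\<close>)

lemma imp_le_join_imp:
  assumes "x \<in> carrier A" "y \<in> carrier A" "z \<in> carrier A"
  shows "x \<^bold>\<rightarrow> y \<^bold>\<le> (x \<^bold>\<or> z) \<^bold>\<rightarrow> (y \<^bold>\<or> z)"
proof (rule residuation')
  show "(x \<^bold>\<rightarrow> y) \<otimes> (x \<^bold>\<or> z) \<^bold>\<le> y \<^bold>\<or> z"
    using assms
    by (simp add: mult_join_distrib imp_closed) (intro join_mono imp_mp mult_le2; simp add: imp_closed)
qed (use assms in \<open>simp_all add: imp_closed join_closed\<close>)

lemma imp_le_meet_imp:
  assumes "x \<in> carrier A" "y \<in> carrier A" "z \<in> carrier A"
  shows "x \<^bold>\<rightarrow> y \<^bold>\<le> (x \<^bold>\<and> z) \<^bold>\<rightarrow> (y \<^bold>\<and> z)"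
proof (intro residuation' meet_greatest)
  show "(x \<^bold>\<rightarrow> y) \<otimes> (x \<^bold>\<and> z) \<^bold>\<le> y"
    using assms
    by (intro le_trans[OF _ _ _ mult_mono_right[OF _ _ _ meet_le1] imp_mp])
      (simp_all add: imp_closed meet_closed)
  show "(x \<^bold>\<rightarrow> y) \<otimes> (x \<^bold>\<and> z) \<^bold>\<le> z"
    using assms
    by (intro le_trans[OF _ _ _ mult_le2 meet_le2]) (simp_all add: imp_closed meet_closed)
qed (use assms in \<open>simp_all add: imp_closed meet_closed\<close>)

lemma imp_le_imp_imp_right:
  assumes "x \<in> carrier A" "y \<in> carrier A" "z \<in> carrier A"
  shows "x \<^bold>\<rightarrow> y \<^bold>\<le> (z \<^bold>\<rightarrow> x) \<^bold>\<rightarrow> (z \<^bold>\<rightarrow> y)"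
  using assms imp_trans_le[of z x y] by (simp add: residuation imp_closed m_comm)

lemma imp_le_imp_imp_left:
  assumes "x \<in> carrier A" "y \<in> carrier A" "z \<in> carrier A"
  shows "x \<^bold>\<rightarrow> y \<^bold>\<le> (y \<^bold>\<rightarrow> z) \<^bold>\<rightarrow> (x \<^bold>\<rightarrow> z)"
  using assms imp_trans_le[of x y z] by (simp add: residuation imp_closed)

end


section \<open>Homomorphic images\<close>

definition rl_hom :: "('a, 'b) reslat_scheme \<Rightarrow> ('c, 'd) reslat_scheme \<Rightarrow> ('a \<Rightarrow> 'c) set"
  where "rl_hom A B = {h \<in> carrier A \<rightarrow> carrier B.
    (\<forall>x\<in>carrier A. \<forall>y\<in>carrier A.
      h (x \<otimes>\<^bsub>A\<^esub> y) = h x \<otimes>\<^bsub>B\<^esub> h y \<and> h (x \<^bold>\<or>\<^bsub>A\<^esub> y) = h x \<^bold>\<or>\<^bsub>B\<^esub> h y \<and>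
      h (x \<^bold>\<and>\<^bsub>A\<^esub> y) = h x \<^bold>\<and>\<^bsub>B\<^esub> h y \<and> h (x \<^bold>\<rightarrow>\<^bsub>A\<^esub> y) = h x \<^bold>\<rightarrow>\<^bsub>B\<^esub> h y) \<and>
    h \<one>\<^bsub>A\<^esub> = \<one>\<^bsub>B\<^esub> \<and> h \<zero>\<^bsub>A\<^esub> = \<zero>\<^bsub>B\<^esub>}"

lemma rl_homD:
  assumes "h \<in> rl_hom A B"
  shows "x \<in> carrier A \<Longrightarrow> h x \<in> carrier B"
    and "x \<in> carrier A \<Longrightarrow> y \<in> carrier A \<Longrightarrow> h (x \<otimes>\<^bsub>A\<^esub> y) = h x \<otimes>\<^bsub>B\<^esub> h y"
    and "x \<in> carrier A \<Longrightarrow> y \<in> carrier A \<Longrightarrow> h (x \<^bold>\<or>\<^bsub>A\<^esub> y) = h x \<^bold>\<or>\<^bsub>B\<^esub> h y"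
    and "x \<in> carrier A \<Longrightarrow> y \<in> carrier A \<Longrightarrow> h (x \<^bold>\<and>\<^bsub>A\<^esub> y) = h x \<^bold>\<and>\<^bsub>B\<^esub> h y"
    and "x \<in> carrier A \<Longrightarrow> y \<in> carrier A \<Longrightarrow> h (x \<^bold>\<rightarrow>\<^bsub>A\<^esub> y) = h x \<^bold>\<rightarrow>\<^bsub>B\<^esub> h y"
    and "h \<one>\<^bsub>A\<^esub> = \<one>\<^bsub>B\<^esub>" and "h \<zero>\<^bsub>A\<^esub> = \<zero>\<^bsub>B\<^esub>"
  using assms by (auto simp: rl_hom_def)

text \<open>Residuated lattices form a variety axiomatised by identities in three variables, so it is
  enough that any three elements lie in a common homomorphic image.\<close>

lemma residuated_lattice_if_locally_image:
  fixes B :: "('c, 'd) reslat_scheme"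
  assumes nonempty: "carrier B \<noteq> {}"
    and local: "\<And>x y z. x \<in> carrier B \<Longrightarrow> y \<in> carrier B \<Longrightarrow> z \<in> carrier B \<Longrightarrow>
      \<exists>(L :: ('a, 'b) reslat_scheme) h.
        residuated_lattice L \<and> h \<in> rl_hom L B \<and> {x, y, z} \<subseteq> h ` carrier L"
  shows "residuated_lattice B"
proof -
  have ident: "\<exists>(L :: ('a, 'b) reslat_scheme) h a b c. residuated_lattice L \<and> h \<in> rl_hom L B \<and>
      a \<in> carrier L \<and> b \<in> carrier L \<and> c \<in> carrier L \<and> x = h a \<and> y = h b \<and> z = h c"
    if "x \<in> carrier B" "y \<in> carrier B" "z \<in> carrier B" for x y z
    using local[OF that] by auto blast
  note hom = rl_homD(2-5)[symmetric]
  have closed: "x \<otimes>\<^bsub>B\<^esub> y \<in> carrier B" "x \<^bold>\<or>\<^bsub>B\<^esub> y \<in> carrier B" "x \<^bold>\<and>\<^bsub>B\<^esub> y \<in> carrier B"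
    "x \<^bold>\<rightarrow>\<^bsub>B\<^esub> y \<in> carrier B" if xy: "x \<in> carrier B" "y \<in> carrier B" for x y
  proof -
    obtain L :: "('a, 'b) reslat_scheme" and h a b where "residuated_lattice L" and h: "h \<in> rl_hom L B"
      and ab: "a \<in> carrier L" "b \<in> carrier L" "x = h a" "y = h b"
      using ident[OF xy xy(1)] by blast
    interpret L: residuated_lattice L by fact
    note hom[OF h, simp] rl_homD(1)[OF h, simp]
    show "x \<otimes>\<^bsub>B\<^esub> y \<in> carrier B" "x \<^bold>\<or>\<^bsub>B\<^esub> y \<in> carrier B" "x \<^bold>\<and>\<^bsub>B\<^esub> y \<in> carrier B"
      "x \<^bold>\<rightarrow>\<^bsub>B\<^esub> y \<in> carrier B"
      using ab by (simp_all add: L.join_closed L.meet_closed L.imp_closed)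
  qed
  \<comment> \<open>Even the constants need some homomorphism into \<open>B\<close>; nonemptiness
    provides an element at which the local hypothesis can be used.\<close>
  have bounds: "\<one>\<^bsub>B\<^esub> \<in> carrier B" "\<zero>\<^bsub>B\<^esub> \<in> carrier B"
  proof -
    obtain x where x: "x \<in> carrier B"
      using nonempty by blast
    obtain L :: "('a, 'b) reslat_scheme" and h where "residuated_lattice L" and h: "h \<in> rl_hom L B"
      using ident[OF x x x] by blast
    interpret L: residuated_lattice L by fact
    show "\<one>\<^bsub>B\<^esub> \<in> carrier B" "\<zero>\<^bsub>B\<^esub> \<in> carrier B"
      using rl_homD(1)[OF h L.one_closed] rl_homD(1)[OF h L.zero_closed] rl_homD(6,7)[OF h] by auto
  qed
  \<comment> \<open>The last three equations replace residuation: unit and counit of the adjunction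
    written as identities, and distributivity of \<otimes> over joins, which encodes
    monotonicity.\<close>
  have eqs: "(x \<otimes>\<^bsub>B\<^esub> y) \<otimes>\<^bsub>B\<^esub> z = x \<otimes>\<^bsub>B\<^esub> (y \<otimes>\<^bsub>B\<^esub> z)" "x \<otimes>\<^bsub>B\<^esub> y = y \<otimes>\<^bsub>B\<^esub> x" "\<one>\<^bsub>B\<^esub> \<otimes>\<^bsub>B\<^esub> x = x"
      "(x \<^bold>\<or>\<^bsub>B\<^esub> y) \<^bold>\<or>\<^bsub>B\<^esub> z = x \<^bold>\<or>\<^bsub>B\<^esub> (y \<^bold>\<or>\<^bsub>B\<^esub> z)" "(x \<^bold>\<and>\<^bsub>B\<^esub> y) \<^bold>\<and>\<^bsub>B\<^esub> z = x \<^bold>\<and>\<^bsub>B\<^esub> (y \<^bold>\<and>\<^bsub>B\<^esub> z)"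
      "x \<^bold>\<or>\<^bsub>B\<^esub> y = y \<^bold>\<or>\<^bsub>B\<^esub> x" "x \<^bold>\<and>\<^bsub>B\<^esub> y = y \<^bold>\<and>\<^bsub>B\<^esub> x" "x \<^bold>\<or>\<^bsub>B\<^esub> (x \<^bold>\<and>\<^bsub>B\<^esub> y) = x" "x \<^bold>\<and>\<^bsub>B\<^esub> (x \<^bold>\<or>\<^bsub>B\<^esub> y) = x"
      "x \<^bold>\<and>\<^bsub>B\<^esub> \<one>\<^bsub>B\<^esub> = x" "\<zero>\<^bsub>B\<^esub> \<^bold>\<and>\<^bsub>B\<^esub> x = \<zero>\<^bsub>B\<^esub>"
      "x \<^bold>\<and>\<^bsub>B\<^esub> (y \<^bold>\<rightarrow>\<^bsub>B\<^esub> ((x \<otimes>\<^bsub>B\<^esub> y) \<^bold>\<or>\<^bsub>B\<^esub> z)) = x" "((y \<^bold>\<rightarrow>\<^bsub>B\<^esub> z) \<otimes>\<^bsub>B\<^esub> y) \<^bold>\<or>\<^bsub>B\<^esub> z = z"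
      "(x \<^bold>\<or>\<^bsub>B\<^esub> y) \<otimes>\<^bsub>B\<^esub> z = (x \<otimes>\<^bsub>B\<^esub> z) \<^bold>\<or>\<^bsub>B\<^esub> (y \<otimes>\<^bsub>B\<^esub> z)"
    if xyz: "x \<in> carrier B" "y \<in> carrier B" "z \<in> carrier B" for x y z
  proof -
    obtain L :: "('a, 'b) reslat_scheme" and h a b c
      where "residuated_lattice L" and h: "h \<in> rl_hom L B"
        and abc: "a \<in> carrier L" "b \<in> carrier L" "c \<in> carrier L" "x = h a" "y = h b" "z = h c"
      using ident[OF xyz] by blast
    interpret L: residuated_lattice L by fact
    note hom[OF h, simp] rl_homD(6,7)[OF h, symmetric, simp]
    note L.join_closed[simp] L.meet_closed[simp] L.imp_closed[simp] L.zero_closed[simp]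
    have "a \<^bold>\<and>\<^bsub>L\<^esub> (b \<^bold>\<rightarrow>\<^bsub>L\<^esub> ((a \<otimes>\<^bsub>L\<^esub> b) \<^bold>\<or>\<^bsub>L\<^esub> c)) = a"
      using abc by (simp add: L.residuation L.le_join1 flip: rl_le_def)
    moreover have "((b \<^bold>\<rightarrow>\<^bsub>L\<^esub> c) \<otimes>\<^bsub>L\<^esub> b) \<^bold>\<or>\<^bsub>L\<^esub> c = c"
      using abc by (simp add: L.imp_mp flip: L.le_iff_join)
    moreover have "a \<^bold>\<and>\<^bsub>L\<^esub> \<one>\<^bsub>L\<^esub> = a"
      using abc L.one_greatest by (simp flip: rl_le_def)
    ultimately show "(x \<otimes>\<^bsub>B\<^esub> y) \<otimes>\<^bsub>B\<^esub> z = x \<otimes>\<^bsub>B\<^esub> (y \<otimes>\<^bsub>B\<^esub> z)" "x \<otimes>\<^bsub>B\<^esub> y = y \<otimes>\<^bsub>B\<^esub> x" "\<one>\<^bsub>B\<^esub> \<otimes>\<^bsub>B\<^esub> x = x"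
        "(x \<^bold>\<or>\<^bsub>B\<^esub> y) \<^bold>\<or>\<^bsub>B\<^esub> z = x \<^bold>\<or>\<^bsub>B\<^esub> (y \<^bold>\<or>\<^bsub>B\<^esub> z)" "(x \<^bold>\<and>\<^bsub>B\<^esub> y) \<^bold>\<and>\<^bsub>B\<^esub> z = x \<^bold>\<and>\<^bsub>B\<^esub> (y \<^bold>\<and>\<^bsub>B\<^esub> z)"
        "x \<^bold>\<or>\<^bsub>B\<^esub> y = y \<^bold>\<or>\<^bsub>B\<^esub> x" "x \<^bold>\<and>\<^bsub>B\<^esub> y = y \<^bold>\<and>\<^bsub>B\<^esub> x" "x \<^bold>\<or>\<^bsub>B\<^esub> (x \<^bold>\<and>\<^bsub>B\<^esub> y) = x" "x \<^bold>\<and>\<^bsub>B\<^esub> (x \<^bold>\<or>\<^bsub>B\<^esub> y) = x"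
        "x \<^bold>\<and>\<^bsub>B\<^esub> \<one>\<^bsub>B\<^esub> = x" "\<zero>\<^bsub>B\<^esub> \<^bold>\<and>\<^bsub>B\<^esub> x = \<zero>\<^bsub>B\<^esub>"
        "x \<^bold>\<and>\<^bsub>B\<^esub> (y \<^bold>\<rightarrow>\<^bsub>B\<^esub> ((x \<otimes>\<^bsub>B\<^esub> y) \<^bold>\<or>\<^bsub>B\<^esub> z)) = x" "((y \<^bold>\<rightarrow>\<^bsub>B\<^esub> z) \<otimes>\<^bsub>B\<^esub> y) \<^bold>\<or>\<^bsub>B\<^esub> z = z"
        "(x \<^bold>\<or>\<^bsub>B\<^esub> y) \<otimes>\<^bsub>B\<^esub> z = (x \<otimes>\<^bsub>B\<^esub> z) \<^bold>\<or>\<^bsub>B\<^esub> (y \<otimes>\<^bsub>B\<^esub> z)"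
      using abc
      by (simp_all add: L.m_assoc L.join_assoc L.meet_assoc
          L.join_absorb L.meet_absorb L.meet_zero_left L.join_mult_distrib)
        (simp_all add: L.m_comm[of a b] L.join_comm[of a b] L.meet_comm[of a b])
  qed
  have mult_one: "x \<otimes>\<^bsub>B\<^esub> \<one>\<^bsub>B\<^esub> = x" if "x \<in> carrier B" for x
    using eqs(2)[of x "\<one>\<^bsub>B\<^esub>" x] eqs(3)[of x x x] that bounds by simp
  have join_le: "x \<^bold>\<and>\<^bsub>B\<^esub> y = x \<longleftrightarrow> x \<^bold>\<or>\<^bsub>B\<^esub> y = y" if "x \<in> carrier B" "y \<in> carrier B" for x y
    using that eqs(6)[of x y x] eqs(7)[of x y x] eqs(8)[of y x x] eqs(9)[of x y x] by metis
  have resid: "x \<^bold>\<and>\<^bsub>B\<^esub> (y \<^bold>\<rightarrow>\<^bsub>B\<^esub> z) = x \<longleftrightarrow> (x \<otimes>\<^bsub>B\<^esub> y) \<^bold>\<and>\<^bsub>B\<^esub> z = x \<otimes>\<^bsub>B\<^esub> y"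
    if in_B: "x \<in> carrier B" "y \<in> carrier B" "z \<in> carrier B" for x y z
  proof
    assume *: "x \<^bold>\<and>\<^bsub>B\<^esub> (y \<^bold>\<rightarrow>\<^bsub>B\<^esub> z) = x"
    let ?w = "(y \<^bold>\<rightarrow>\<^bsub>B\<^esub> z) \<otimes>\<^bsub>B\<^esub> y"
    have "x \<^bold>\<or>\<^bsub>B\<^esub> (y \<^bold>\<rightarrow>\<^bsub>B\<^esub> z) = y \<^bold>\<rightarrow>\<^bsub>B\<^esub> z"
      using * join_le in_B closed by simp
    \<comment> \<open>Monotonicity, read off from distributivity: \<open>x \<otimes> y\<close> lies
      below \<open>(y \<rightarrow> z) \<otimes> y\<close>, which the counit identity puts below
      \<open>z\<close>.\<close>
    then have "(x \<otimes>\<^bsub>B\<^esub> y) \<^bold>\<or>\<^bsub>B\<^esub> ?w = ?w"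
      using eqs(14)[of x "y \<^bold>\<rightarrow>\<^bsub>B\<^esub> z" y] in_B closed by simp
    moreover have "?w \<^bold>\<or>\<^bsub>B\<^esub> z = z"
      using eqs(13) in_B by blast
    ultimately have "(x \<otimes>\<^bsub>B\<^esub> y) \<^bold>\<or>\<^bsub>B\<^esub> z = z"
      using eqs(4)[of "x \<otimes>\<^bsub>B\<^esub> y" ?w z] in_B closed by simp
    then show "(x \<otimes>\<^bsub>B\<^esub> y) \<^bold>\<and>\<^bsub>B\<^esub> z = x \<otimes>\<^bsub>B\<^esub> y"
      using join_le in_B closed by simp
  next
    assume "(x \<otimes>\<^bsub>B\<^esub> y) \<^bold>\<and>\<^bsub>B\<^esub> z = x \<otimes>\<^bsub>B\<^esub> y"
    then have "(x \<otimes>\<^bsub>B\<^esub> y) \<^bold>\<or>\<^bsub>B\<^esub> z = z"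
      using join_le in_B closed by simp
    \<comment> \<open>The unit identity puts \<open>x\<close> below
      \<open>y \<rightarrow> ((x \<otimes> y) \<or> z)\<close>, and here that join is
      \<open>z\<close>.\<close>
    then show "x \<^bold>\<and>\<^bsub>B\<^esub> (y \<^bold>\<rightarrow>\<^bsub>B\<^esub> z) = x"
      using eqs(12)[OF in_B] by simp
  qed
  show ?thesis
    by unfold_locales (unfold rl_le_def, (rule eqs closed bounds resid mult_one; assumption?)+)
qed


section \<open>Quotients and products\<close>

context residuated_lattice
begin

section \<open>Filters, their congruences and quotients\<close>

lemma rl_filter_up:
  "rl_filter A F \<Longrightarrow> x \<in> F \<Longrightarrow> x \<^bold>\<le> y \<Longrightarrow> y \<in> carrier A \<Longrightarrow> y \<in> F"
  by (simp add: rl_filter_def)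

lemma rl_filter_one:
  assumes "rl_filter A F"
  shows "\<one> \<in> F"
proof -
  obtain x where "x \<in> F" "x \<in> carrier A"
    using assms by (auto simp: rl_filter_def)
  then show ?thesis
    using rl_filter_up[OF assms, of x \<one>] one_greatest by simp
qed

text \<open>The product lies below the meet, so closure under \<otimes> yields closure under meets.
  This splits the defining condition of the congruence into two memberships.\<close>

lemma rl_filter_meet_iff:
  assumes "rl_filter A F" "x \<in> carrier A" "y \<in> carrier A"
  shows "x \<^bold>\<and> y \<in> F \<longleftrightarrow> x \<in> F \<and> y \<in> F"
proof
  show "x \<^bold>\<and> y \<in> F \<Longrightarrow> x \<in> F \<and> y \<in> F"
    using assms rl_filter_up[OF assms(1) _ meet_le1[of x y]]
      rl_filter_up[OF assms(1) _ meet_le2[of x y]] by simp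
  have "x \<otimes> y \<^bold>\<le> x \<^bold>\<and> y"
    using assms by (intro meet_greatest mult_le1 mult_le2) simp_all
  then show "x \<in> F \<and> y \<in> F \<Longrightarrow> x \<^bold>\<and> y \<in> F"
    using assms rl_filter_up[of F "x \<otimes> y" "x \<^bold>\<and> y"] by (simp add: rl_filter_def meet_closed)
qed

lemma filter_cong_iff:
  assumes "rl_filter A F"
  shows "(x, y) \<in> filter_cong A F \<longleftrightarrow>
    x \<in> carrier A \<and> y \<in> carrier A \<and> x \<^bold>\<rightarrow> y \<in> F \<and> y \<^bold>\<rightarrow> x \<in> F"
  using rl_filter_meet_iff[OF assms, of "x \<^bold>\<rightarrow> y" "y \<^bold>\<rightarrow> x"]
  by (auto simp: filter_cong_def imp_closed)

lemma equiv_filter_cong: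
  assumes F: "rl_filter A F"
  shows "equiv (carrier A) (filter_cong A F)"
proof (intro equivI)
  show "filter_cong A F \<subseteq> carrier A \<times> carrier A"
    by (auto simp: filter_cong_def)
  show "refl_on (carrier A) (filter_cong A F)"
    by (auto simp: refl_on_def filter_cong_iff[OF F] imp_self rl_filter_one[OF F])
  show "sym (filter_cong A F)"
    by (auto simp: sym_def filter_cong_iff[OF F])
  have "x \<^bold>\<rightarrow> z \<in> F" if "x \<in> carrier A" "y \<in> carrier A" "z \<in> carrier A" "x \<^bold>\<rightarrow> y \<in> F" "y \<^bold>\<rightarrow> z \<in> F" for x y z
    using that rl_filter_up[OF F _ imp_trans_le[of x y z]] F by (simp add: rl_filter_def imp_closed)
  then show "trans (filter_cong A F)"
    unfolding trans_def filter_cong_iff[OF F] by blast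
qed

lemma filter_cong_ops:
  assumes F: "rl_filter A F" and xy: "(x, x') \<in> filter_cong A F" "(y, y') \<in> filter_cong A F"
  shows "(x \<otimes> y, x' \<otimes> y') \<in> filter_cong A F"
    and "(x \<^bold>\<or> y, x' \<^bold>\<or> y') \<in> filter_cong A F"
    and "(x \<^bold>\<and> y, x' \<^bold>\<and> y') \<in> filter_cong A F"
    and "(x \<^bold>\<rightarrow> y, x' \<^bold>\<rightarrow> y') \<in> filter_cong A F"
proof -
  note cong = filter_cong_iff[OF F]
  note up = rl_filter_up[OF F]
  have tr: "(u, w) \<in> filter_cong A F" if "(u, v) \<in> filter_cong A F" "(v, w) \<in> filter_cong A F" for u v w
    using equiv_filter_cong[OF F] that by (meson equiv_def transD)
  \<comment> \<open>Compatibility is reduced to changing one argument at a time; transitivity and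
    commutativity then combine two such changes, while \<rightarrow> needs its own lemma for each
    side.\<close>
  have one_sided: "(u \<otimes> w, v \<otimes> w) \<in> filter_cong A F" "(u \<^bold>\<or> w, v \<^bold>\<or> w) \<in> filter_cong A F"
    "(u \<^bold>\<and> w, v \<^bold>\<and> w) \<in> filter_cong A F" "(w \<^bold>\<rightarrow> u, w \<^bold>\<rightarrow> v) \<in> filter_cong A F"
    "(u \<^bold>\<rightarrow> w, v \<^bold>\<rightarrow> w) \<in> filter_cong A F"
    if "(u, v) \<in> filter_cong A F" "w \<in> carrier A" for u v w
  proof -
    have uv: "u \<in> carrier A" "v \<in> carrier A" "u \<^bold>\<rightarrow> v \<in> F" "v \<^bold>\<rightarrow> u \<in> F"
      using that(1) unfolding cong by auto
    note closed = m_closed join_closed meet_closed imp_closed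
    show "(u \<otimes> w, v \<otimes> w) \<in> filter_cong A F"
      unfolding cong using uv that(2) imp_le_mult_imp by (auto intro!: closed intro: up)
    show "(u \<^bold>\<or> w, v \<^bold>\<or> w) \<in> filter_cong A F"
      unfolding cong using uv that(2) imp_le_join_imp by (auto intro!: closed intro: up)
    show "(u \<^bold>\<and> w, v \<^bold>\<and> w) \<in> filter_cong A F"
      unfolding cong using uv that(2) imp_le_meet_imp by (auto intro!: closed intro: up)
    show "(w \<^bold>\<rightarrow> u, w \<^bold>\<rightarrow> v) \<in> filter_cong A F"
      unfolding cong using uv that(2) imp_le_imp_imp_right by (auto intro!: closed intro: up)
    show "(u \<^bold>\<rightarrow> w, v \<^bold>\<rightarrow> w) \<in> filter_cong A F"
      unfolding cong using uv that(2) imp_le_imp_imp_left by (auto intro!: closed intro: up)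
  qed
  have in_A: "x \<in> carrier A" "y \<in> carrier A" "x' \<in> carrier A" "y' \<in> carrier A"
    using xy unfolding cong by auto
  show "(x \<otimes> y, x' \<otimes> y') \<in> filter_cong A F"
    using tr[OF one_sided(1)[OF xy(1) in_A(2)]] one_sided(1)[OF xy(2) in_A(3)] in_A by (simp add: m_comm)
  show "(x \<^bold>\<or> y, x' \<^bold>\<or> y') \<in> filter_cong A F"
    using tr[OF one_sided(2)[OF xy(1) in_A(2)]] one_sided(2)[OF xy(2) in_A(3)] in_A
    by (simp add: join_comm)
  show "(x \<^bold>\<and> y, x' \<^bold>\<and> y') \<in> filter_cong A F"
    using tr[OF one_sided(3)[OF xy(1) in_A(2)]] one_sided(3)[OF xy(2) in_A(3)] in_A
    by (simp add: meet_comm)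
  show "(x \<^bold>\<rightarrow> y, x' \<^bold>\<rightarrow> y') \<in> filter_cong A F"
    using tr[OF one_sided(5)[OF xy(1) in_A(2)] one_sided(4)[OF xy(2) in_A(3)]] in_A by simp
qed

lemma rl_class_eq_iff:
  assumes "rl_filter A F" "x \<in> carrier A" "y \<in> carrier A"
  shows "rl_class A F x = rl_class A F y \<longleftrightarrow> (x, y) \<in> filter_cong A F"
  unfolding rl_class_def using eq_equiv_class_iff[OF equiv_filter_cong] assms by blast

lemma rl_class_self: "rl_filter A F \<Longrightarrow> x \<in> carrier A \<Longrightarrow> x \<in> rl_class A F x"
  unfolding rl_class_def using equiv_class_self[OF equiv_filter_cong] by blast

lemma mem_rl_class_iff: "y \<in> rl_class A F x \<longleftrightarrow> (x, y) \<in> filter_cong A F"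
  by (simp add: rl_class_def)

text \<open>One of the two implications, \<open>x \<rightarrow> \<one>\<close>, is always \<one>,
  and the other, \<open>\<one> \<rightarrow> x\<close>, is \<open>x\<close> itself.\<close>

lemma rl_class_eq_one_iff:
  assumes F: "rl_filter A F" and "x \<in> carrier A"
  shows "rl_class A F x = rl_class A F \<one> \<longleftrightarrow> x \<in> F"
proof -
  have "x \<^bold>\<rightarrow> \<one> = \<one>"
    using assms one_greatest imp_one_iff by simp
  then show ?thesis
    using assms rl_filter_one[OF F]
    by (simp add: rl_class_eq_iff[OF F] filter_cong_iff[OF F] one_imp)
qed

text \<open>The union over all pairs of representatives collapses because every pair yields the same
  class. The operation \<open>g\<close> is a parameter so that all four operations are covered at
  once.\<close>

lemma quot_op_class:
  assumes F: "rl_filter A F" and "x \<in> carrier A" "y \<in> carrier A"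
    and cong: "\<And>x' y'. (x, x') \<in> filter_cong A F \<Longrightarrow> (y, y') \<in> filter_cong A F \<Longrightarrow>
      (g x y, g x' y') \<in> filter_cong A F"
  shows "quot_op A F g (rl_class A F x) (rl_class A F y) = rl_class A F (g x y)"
proof -
  have "rl_class A F (g x' y') = rl_class A F (g x y)"
    if "x' \<in> rl_class A F x" "y' \<in> rl_class A F y" for x' y'
    unfolding rl_class_def
    using equiv_class_eq[OF equiv_filter_cong[OF F] cong[of x' y']] that
    by (simp add: mem_rl_class_iff)
  moreover have "x \<in> rl_class A F x" "y \<in> rl_class A F y"
    using assms by (simp_all add: rl_class_self)
  ultimately show ?thesis
    unfolding quot_op_def by blast
qed

lemma rl_class_hom:
  assumes F: "rl_filter A F"
  shows "rl_class A F \<in> rl_hom A (rl_quotient A F)"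
proof -
  have "rl_class A F x \<in> carrier A // filter_cong A F" if "x \<in> carrier A" for x
    using that by (simp add: rl_class_def quotientI)
  then show ?thesis
    using F by (simp add: rl_hom_def rl_quotient_def quot_op_class filter_cong_ops Pi_iff)
qed

lemma carrier_rl_quotient: "carrier (rl_quotient A F) = rl_class A F ` carrier A"
  by (auto simp: rl_quotient_def quotient_def rl_class_def)

text \<open>The class map is onto, so \<open>A\<close> itself serves as the homomorphic preimage for
  every triple.\<close>

lemma residuated_lattice_quotient:
  assumes F: "rl_filter A F"
  shows "residuated_lattice (rl_quotient A F)"
proof (rule residuated_lattice_if_locally_image)
  show "carrier (rl_quotient A F) \<noteq> {}"
    using one_closed by (auto simp: carrier_rl_quotient)
  fix x y z
  assume "x \<in> carrier (rl_quotient A F)" "y \<in> carrier (rl_quotient A F)" "z \<in> carrier (rl_quotient A F)"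
  then have "{x, y, z} \<subseteq> rl_class A F ` carrier A"
    by (simp add: carrier_rl_quotient)
  then show "\<exists>(L :: ('a, 'b) reslat_scheme) h. residuated_lattice L \<and> h \<in> rl_hom L (rl_quotient A F) \<and> {x, y, z} \<subseteq> h ` carrier L"
    using rl_class_hom[OF F] residuated_lattice_axioms
    by (intro exI[of _ A] exI[of _ "rl_class A F"] conjI)
qed

end

text \<open>Membership in the carrier makes \<open>u\<close> extensional, so that \<open>u\<close>
  can equal the restricted function that is its meet with \<open>v\<close>.\<close>

lemma rl_product_le_iff:
  assumes "u \<in> carrier (rl_product I L)"
  shows "u \<^bold>\<le>\<^bsub>rl_product I L\<^esub> v \<longleftrightarrow> (\<forall>i\<in>I. u i \<^bold>\<le>\<^bsub>L i\<^esub> v i)"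
  using assms by (auto simp: rl_le_def rl_product_def fun_eq_iff restrict_def PiE_def extensional_def)

text \<open>All laws are checked componentwise. An empty index set is included and gives the
  one-element algebra, which is needed for the empty partition.\<close>

lemma residuated_lattice_product:
  fixes L :: "'i \<Rightarrow> ('a, 'b) reslat_scheme"
  assumes "\<And>i. i \<in> I \<Longrightarrow> residuated_lattice (L i)"
  shows "residuated_lattice (rl_product I L)"
proof -
  note RL = assms
  note cm = residuated_lattice.axioms(1)[OF RL]
  note mon = comm_monoid.axioms(1)[OF cm]
  have ext: "u = v" if "u \<in> carrier (rl_product I L)" "v \<in> carrier (rl_product I L)"
    "\<And>i. i \<in> I \<Longrightarrow> u i = v i" for u v
    using that by (auto simp: rl_product_def intro: PiE_ext)
  have comp: "u i \<in> carrier (L i)" if "u \<in> carrier (rl_product I L)" "i \<in> I" for u i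
    using that by (simp add: rl_product_def PiE_iff)
  have closed: "u \<otimes>\<^bsub>rl_product I L\<^esub> v \<in> carrier (rl_product I L)"
    "u \<^bold>\<or>\<^bsub>rl_product I L\<^esub> v \<in> carrier (rl_product I L)"
    "u \<^bold>\<and>\<^bsub>rl_product I L\<^esub> v \<in> carrier (rl_product I L)"
    "u \<^bold>\<rightarrow>\<^bsub>rl_product I L\<^esub> v \<in> carrier (rl_product I L)"
    if "u \<in> carrier (rl_product I L)" "v \<in> carrier (rl_product I L)" for u v
    using that
    by (simp_all add: rl_product_def PiE_iff residuated_lattice.join_closed[OF RL]
        residuated_lattice.meet_closed[OF RL] residuated_lattice.imp_closed[OF RL] monoid.m_closed[OF mon])
  have bounds: "\<one>\<^bsub>rl_product I L\<^esub> \<in> carrier (rl_product I L)" "\<zero>\<^bsub>rl_product I L\<^esub> \<in> carrier (rl_product I L)"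
    by (simp_all add: rl_product_def PiE_iff residuated_lattice.zero_closed[OF RL] monoid.one_closed[OF mon])
  have ops: "(u \<otimes>\<^bsub>rl_product I L\<^esub> v) i = u i \<otimes>\<^bsub>L i\<^esub> v i"
    "(u \<^bold>\<or>\<^bsub>rl_product I L\<^esub> v) i = u i \<^bold>\<or>\<^bsub>L i\<^esub> v i" "(u \<^bold>\<and>\<^bsub>rl_product I L\<^esub> v) i = u i \<^bold>\<and>\<^bsub>L i\<^esub> v i"
    "(u \<^bold>\<rightarrow>\<^bsub>rl_product I L\<^esub> v) i = u i \<^bold>\<rightarrow>\<^bsub>L i\<^esub> v i" "\<one>\<^bsub>rl_product I L\<^esub> i = \<one>\<^bsub>L i\<^esub>" "\<zero>\<^bsub>rl_product I L\<^esub> i = \<zero>\<^bsub>L i\<^esub>"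
    if "i \<in> I" for u v i
    using that by (simp_all add: rl_product_def)
  note laws = monoid.m_assoc[OF mon] monoid.l_one[OF mon] monoid.r_one[OF mon] comm_monoid.m_comm[OF cm]
    residuated_lattice.join_comm[OF RL] residuated_lattice.meet_comm[OF RL]
    residuated_lattice.join_assoc[OF RL] residuated_lattice.meet_assoc[OF RL]
    residuated_lattice.join_absorb[OF RL] residuated_lattice.meet_absorb[OF RL]
  show ?thesis
    by unfold_locales
      (simp_all only: rl_product_le_iff closed bounds,
       (fact closed bounds | (rule ext; simp add: closed bounds ops comp; rule laws; simp add: comp) |
         simp add: ops comp residuated_lattice.zero_least[OF RL] residuated_lattice.one_greatest[OF RL]
           residuated_lattice.residuation[OF RL])+)
qed


section \<open>Direct limits\<close>

locale inductive_system =
  fixes I :: "'i set" and leq :: "'i \<Rightarrow> 'i \<Rightarrow> bool"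
    and L :: "'i \<Rightarrow> ('a, 'b) reslat_scheme" and f :: "'i \<Rightarrow> 'i \<Rightarrow> 'a \<Rightarrow> 'a"
  assumes nonempty: "I \<noteq> {}"
    and directed: "i \<in> I \<Longrightarrow> j \<in> I \<Longrightarrow> \<exists>k\<in>I. leq i k \<and> leq j k"
    and leq_trans: "i \<in> I \<Longrightarrow> j \<in> I \<Longrightarrow> k \<in> I \<Longrightarrow> leq i j \<Longrightarrow> leq j k \<Longrightarrow> leq i k"
    and residuated_lattice_L: "i \<in> I \<Longrightarrow> residuated_lattice (L i)"
    and f_hom: "i \<in> I \<Longrightarrow> j \<in> I \<Longrightarrow> leq i j \<Longrightarrow> f i j \<in> rl_hom (L i) (L j)"
    and f_comp: "i \<in> I \<Longrightarrow> j \<in> I \<Longrightarrow> k \<in> I \<Longrightarrow> leq i j \<Longrightarrow> leq j k \<Longrightarrow> x \<in> carrier (L i) \<Longrightarrow>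
      f j k (f i j x) = f i k x"
begin

abbreviation germ :: "'i \<Rightarrow> 'a \<Rightarrow> ('i \<times> 'a) set"
  where "germ i x \<equiv> dirlim_rel I leq L f `` {(i, x)}"

lemma equiv_dirlim_rel: "equiv (SIGMA i:I. carrier (L i)) (dirlim_rel I leq L f)"
proof (intro equivI)
  show "dirlim_rel I leq L f \<subseteq> (SIGMA i:I. carrier (L i)) \<times> (SIGMA i:I. carrier (L i))"
    by (auto simp: dirlim_rel_def)
  show "refl_on (SIGMA i:I. carrier (L i)) (dirlim_rel I leq L f)"
    using directed by (fastforce simp: refl_on_def dirlim_rel_def)
  show "sym (dirlim_rel I leq L f)"
    unfolding sym_def dirlim_rel_def by (auto; metis)
  show "trans (dirlim_rel I leq L f)"
  proof (rule transI, clarify)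
    fix i x j y k z
    assume "((i, x), (j, y)) \<in> dirlim_rel I leq L f" "((j, y), (k, z)) \<in> dirlim_rel I leq L f"
    then obtain a b where ab: "i \<in> I" "x \<in> carrier (L i)" "j \<in> I" "y \<in> carrier (L j)" "k \<in> I" "z \<in> carrier (L k)"
      "a \<in> I" "leq i a" "leq j a" "f i a x = f j a y" "b \<in> I" "leq j b" "leq k b" "f j b y = f k b z"
      by (auto simp: dirlim_rel_def)
    \<comment> \<open>The two equalities hold at unrelated indices \<open>a\<close> and
      \<open>b\<close>; both are pushed forward to a common bound.\<close>
    obtain c where c: "c \<in> I" "leq a c" "leq b c"
      using directed ab by blast
    have "f i c x = f j c y"
      using f_comp[of i a c x] f_comp[of j a c y] ab c by simp
    also have "f j c y = f k c z"
      using f_comp[of j b c y] f_comp[of k b c z] ab c by simp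
    finally have "f i c x = f k c z" .
    moreover have "leq i c" "leq k c"
      using leq_trans ab c by blast+
    ultimately show "((i, x), (k, z)) \<in> dirlim_rel I leq L f"
      using ab c by (auto simp: dirlim_rel_def)
  qed
qed

lemma germ_eq_iff:
  assumes "i \<in> I" "x \<in> carrier (L i)" "j \<in> I" "y \<in> carrier (L j)"
  shows "germ i x = germ j y \<longleftrightarrow> (\<exists>k\<in>I. leq i k \<and> leq j k \<and> f i k x = f j k y)"
  using eq_equiv_class_iff[OF equiv_dirlim_rel, of "(i, x)" "(j, y)"] assms
  by (simp add: dirlim_rel_def)

lemma f_closed:
  "i \<in> I \<Longrightarrow> j \<in> I \<Longrightarrow> leq i j \<Longrightarrow> x \<in> carrier (L i) \<Longrightarrow> f i j x \<in> carrier (L j)"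
  using rl_homD(1)[OF f_hom] by blast

lemma germ_f:
  assumes "i \<in> I" "j \<in> I" "leq i j" "x \<in> carrier (L i)"
  shows "germ j (f i j x) = germ i x"
proof -
  \<comment> \<open>The two germs are compared at an index above \<open>j\<close>, where both
    representatives become \<open>f i k x\<close>.\<close>
  obtain k where k: "k \<in> I" "leq j k"
    using directed assms by blast
  then have "leq i k" "f j k (f i j x) = f i k x"
    using assms leq_trans f_comp by blast+
  then show ?thesis
    using assms k f_closed by (subst germ_eq_iff) auto
qed

text \<open>\<open>dirlim_op\<close> takes a union over all representatives and all common bounds,
  so the content is well-definedness. Here \<open>g\<close> ranges over record selectors, and
  closure and compatibility are all that the four operations have to supply.\<close>

lemma dirlim_op_germ:
  assumes i: "i \<in> I" and xy: "x \<in> carrier (L i)" "y \<in> carrier (L i)"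
    and closed: "\<And>k x y. k \<in> I \<Longrightarrow> x \<in> carrier (L k) \<Longrightarrow> y \<in> carrier (L k) \<Longrightarrow> g (L k) x y \<in> carrier (L k)"
    and hom: "\<And>j k x y. j \<in> I \<Longrightarrow> k \<in> I \<Longrightarrow> leq j k \<Longrightarrow> x \<in> carrier (L j) \<Longrightarrow> y \<in> carrier (L j) \<Longrightarrow>
      f j k (g (L j) x y) = g (L k) (f j k x) (f j k y)"
  shows "dirlim_op I leq L f g (germ i x) (germ i y) = germ i (g (L i) x y)"
proof -
  have eq: "germ k (g (L k) (f j k x') (f l k y')) = germ i (g (L i) x y)"
    if x': "(j, x') \<in> germ i x" and y': "(l, y') \<in> germ i y" and k: "k \<in> I" "leq j k" "leq l k" for j x' l y' k
  proof -
    obtain a where a: "j \<in> I" "x' \<in> carrier (L j)" "a \<in> I" "leq i a" "leq j a" "f i a x = f j a x'"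
      using x' by (auto simp: dirlim_rel_def)
    obtain b where b: "l \<in> I" "y' \<in> carrier (L l)" "b \<in> I" "leq i b" "leq l b" "f i b y = f l b y'"
      using y' by (auto simp: dirlim_rel_def)
    obtain c where c: "c \<in> I" "leq a c" "leq b c"
      using directed a b by blast
    \<comment> \<open>The index \<open>k\<close> at which the operation is formed need not lie above
      \<open>c\<close>, where the representatives agree with \<open>x\<close> and \<open>y\<close>;
      \<open>d\<close> dominates both.\<close>
    obtain d where d: "d \<in> I" "leq c d" "leq k d"
      using directed c k by blast
    have leqs: "leq a d" "leq b d" "leq i d"
      using leq_trans a b c d i by blast+
    have "f k d (f j k x') = f i d x"
      using f_comp[of j k d x'] f_comp[of j a d x'] f_comp[of i a d x] a d i k xy leqs by simp
    moreover have "f k d (f l k y') = f i d y"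
      using f_comp[of l k d y'] f_comp[of l b d y'] f_comp[of i b d y] b d i k xy leqs by simp
    ultimately have "f k d (g (L k) (f j k x') (f l k y')) = f i d (g (L i) x y)"
      using a b d k i xy leqs by (simp add: hom f_closed)
    then show ?thesis
      using a b d k i xy leqs by (subst germ_eq_iff) (auto simp: closed f_closed)
  qed
  \<comment> \<open>An index above \<open>i\<close> is needed so that the union defining the
    operation is nonempty and contains the expected class.\<close>
  obtain k where k: "k \<in> I" "leq i k"
    using directed i by blast
  have "(i, x) \<in> germ i x" "(i, y) \<in> germ i y"
    using equiv_class_self[OF equiv_dirlim_rel] i xy by blast+
  note reps = this
  show ?thesis
  proof (rule equalityI)
    show "dirlim_op I leq L f g (germ i x) (germ i y) \<subseteq> germ i (g (L i) x y)"
      unfolding dirlim_op_def using eq by (intro UN_least) (simp add: split_beta)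
    have "germ i (g (L i) x y) = germ k (g (L k) (f i k x) (f i k y))"
      using eq[OF reps] k by simp
    then show "germ i (g (L i) x y) \<subseteq> dirlim_op I leq L f g (germ i x) (germ i y)"
      unfolding dirlim_op_def using reps k
      by (intro subsetI UN_I[of "(i, x)"], simp_all only: prod.case) (intro UN_I[of "(i, y)"], auto)
  qed
qed

lemma dirlim_const_germ:
  assumes "i \<in> I" "\<And>k. k \<in> I \<Longrightarrow> c (L k) \<in> carrier (L k)"
    "\<And>j k. j \<in> I \<Longrightarrow> k \<in> I \<Longrightarrow> leq j k \<Longrightarrow> f j k (c (L j)) = c (L k)"
  shows "(\<Union>j\<in>I. germ j (c (L j))) = germ i (c (L i))"
proof -
  have "germ j (c (L j)) = germ i (c (L i))" if "j \<in> I" for j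
    using directed[OF that assms(1)] assms that by (auto simp: germ_eq_iff)
  then show ?thesis
    using assms(1) by blast
qed

lemma germ_hom:
  assumes i: "i \<in> I"
  shows "germ i \<in> rl_hom (L i) (dirlim I leq L f)"
proof -
  note RL = residuated_lattice_L
  note cm = residuated_lattice.axioms(1)[OF RL]
  note mon = comm_monoid.axioms(1)[OF cm]
  show ?thesis
    unfolding rl_hom_def dirlim_def
    using i
    by (auto simp: dirlim_op_germ rl_homD[OF f_hom] dirlim_const_germ[of i one] dirlim_const_germ[of i rl_zero]
        residuated_lattice.join_closed[OF RL] residuated_lattice.meet_closed[OF RL]
        residuated_lattice.imp_closed[OF RL] residuated_lattice.zero_closed[OF RL]
        monoid.m_closed[OF mon] monoid.one_closed[OF mon] intro!: quotientI)
qed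

lemma dirlim_cases:
  assumes "x \<in> carrier (dirlim I leq L f)"
  obtains i u where "i \<in> I" "u \<in> carrier (L i)" "x = germ i u"
  using assms by (auto simp: dirlim_def elim!: quotientE)

lemma germ_common_index:
  assumes "i \<in> I" "u \<in> carrier (L i)" "j \<in> I" "v \<in> carrier (L j)"
  obtains k u' v' where "k \<in> I" "leq i k" "leq j k" "u' \<in> carrier (L k)" "v' \<in> carrier (L k)"
    "germ i u = germ k u'" "germ j v = germ k v'"
proof -
  obtain k where "k \<in> I" "leq i k" "leq j k"
    using directed assms by blast
  with assms show thesis
    by (intro that[of k "f i k u" "f j k v"]) (simp_all add: germ_f f_closed)
qed

lemma dirlim_cases2:
  assumes "x \<in> carrier (dirlim I leq L f)" "y \<in> carrier (dirlim I leq L f)"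
  obtains k u v where "k \<in> I" "u \<in> carrier (L k)" "v \<in> carrier (L k)" "x = germ k u" "y = germ k v"
  using assms by (metis dirlim_cases germ_common_index)

text \<open>Any three elements have representatives at a common index \<open>k\<close>, and
  \<open>germ k\<close> is a homomorphism. A single stage need not map onto the limit, hence the
  criterion with only three elements at a time.\<close>

lemma residuated_lattice_dirlim: "residuated_lattice (dirlim I leq L f)"
proof (rule residuated_lattice_if_locally_image)
  obtain i where i: "i \<in> I"
    using nonempty by blast
  show "carrier (dirlim I leq L f) \<noteq> {}"
    using rl_homD(1)[OF germ_hom[OF i] residuated_lattice.zero_closed[OF residuated_lattice_L[OF i]]]
    by auto
  fix x y z
  assume xyz: "x \<in> carrier (dirlim I leq L f)" "y \<in> carrier (dirlim I leq L f)"
    "z \<in> carrier (dirlim I leq L f)"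
  obtain i u v where uv: "i \<in> I" "u \<in> carrier (L i)" "v \<in> carrier (L i)" "x = germ i u" "y = germ i v"
    by (rule dirlim_cases2[OF xyz(1,2)])
  obtain j w where w: "j \<in> I" "w \<in> carrier (L j)" "z = germ j w"
    by (rule dirlim_cases[OF xyz(3)])
  obtain k where k: "k \<in> I" "leq i k" "leq j k"
    using directed uv w by blast
  have "{x, y, z} = germ k ` {f i k u, f i k v, f j k w}"
    using uv w k by (simp add: germ_f)
  moreover have "{f i k u, f i k v, f j k w} \<subseteq> carrier (L k)"
    using uv w k by (simp add: f_closed)
  ultimately have "{x, y, z} \<subseteq> germ k ` carrier (L k)"
    by (simp only: image_mono)
  then show "\<exists>(M :: ('a, 'b) reslat_scheme) h.
      residuated_lattice M \<and> h \<in> rl_hom M (dirlim I leq L f) \<and> {x, y, z} \<subseteq> h ` carrier M"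
    using germ_hom[OF k(1)] residuated_lattice_L[OF k(1)]
    by (intro exI[of _ "L k"] exI[of _ "germ k"] conjI)
qed

end


section \<open>Co-annihilators and finite partitions\<close>

context residuated_lattice
begin

section \<open>The Galois connection of co-annihilators and its closed sets\<close>

lemma mem_coann_iff: "a \<in> coann A X \<longleftrightarrow> a \<in> carrier A \<and> (\<forall>x\<in>X. a \<^bold>\<or> x = \<one>)"
  by (simp add: coann_def)

lemma coann_subset: "coann A X \<subseteq> carrier A"
  by (auto simp: coann_def)

lemma coann_antimono: "X \<subseteq> Y \<Longrightarrow> coann A Y \<subseteq> coann A X"
  by (auto simp: coann_def)

lemma subset_coann_iff:
  assumes "X \<subseteq> carrier A" "Y \<subseteq> carrier A"
  shows "X \<subseteq> coann A Y \<longleftrightarrow> (\<forall>x\<in>X. \<forall>y\<in>Y. x \<^bold>\<or> y = \<one>)"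
  using assms by (auto simp: mem_coann_iff)

lemma coann_galois:
  assumes "X \<subseteq> carrier A" "Y \<subseteq> carrier A"
  shows "X \<subseteq> coann A Y \<longleftrightarrow> Y \<subseteq> coann A X"
  using assms join_comm unfolding subset_coann_iff[OF assms] subset_coann_iff[OF assms(2,1)]
  by (metis subsetD)

lemma subset_coann_coann: "X \<subseteq> carrier A \<Longrightarrow> X \<subseteq> coann A (coann A X)"
  using coann_galois[of X "coann A X"] coann_subset by blast

lemma coann_coann_coann:
  assumes "X \<subseteq> carrier A"
  shows "coann A (coann A (coann A X)) = coann A X"
proof (rule equalityI)
  show "coann A (coann A (coann A X)) \<subseteq> coann A X"
    by (rule coann_antimono[OF subset_coann_coann[OF assms]])
qed (rule subset_coann_coann[OF coann_subset])

text \<open>\<open>coann A Y\<close> is closed, so containing \<open>X\<close> is the same as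
  containing the closure of \<open>X\<close>. With generating sets of two traces for
  \<open>X\<close> and \<open>Y\<close>, this turns an inclusion into a condition on pairs of
  generators.\<close>

lemma coann_coann_subset_iff:
  assumes "X \<subseteq> carrier A" "Y \<subseteq> carrier A"
  shows "coann A (coann A X) \<subseteq> coann A Y \<longleftrightarrow> (\<forall>x\<in>X. \<forall>y\<in>Y. x \<^bold>\<or> y = \<one>)"
proof -
  have "coann A (coann A X) \<subseteq> coann A Y" if "X \<subseteq> coann A Y"
    using coann_antimono[OF coann_antimono[OF that]] coann_coann_coann[OF assms(2)] by simp
  then have "coann A (coann A X) \<subseteq> coann A Y \<longleftrightarrow> X \<subseteq> coann A Y"
    using subset_coann_coann[OF assms(1)] by blast
  then show ?thesis
    by (simp only: subset_coann_iff[OF assms])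
qed

lemma rl_filter_coann:
  assumes "X \<subseteq> carrier A"
  shows "rl_filter A (coann A X)"
  unfolding rl_filter_def
proof (intro conjI ballI impI coann_subset)
  show "coann A X \<noteq> {}"
    using assms join_one_left one_closed by (auto simp: coann_def)
  show "y \<in> coann A X" if "x \<in> coann A X" "y \<in> carrier A" "x \<^bold>\<le> y" for x y
    using that assms join_eq_one_mono[of x y] by (auto simp: mem_coann_iff)
  show "x \<otimes> y \<in> coann A X" if "x \<in> coann A X" "y \<in> coann A X" for x y
    using that assms mult_join_eq_one by (auto simp: mem_coann_iff)
qed

lemma CoAnn_iff: "C \<in> CoAnn A \<longleftrightarrow> C \<subseteq> carrier A \<and> coann A (coann A C) = C"
  using coann_subset coann_coann_coann by (auto simp: CoAnn_def) metis

lemma coann_in_CoAnn: "X \<subseteq> carrier A \<Longrightarrow> coann A X \<in> CoAnn A"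
  by (auto simp: CoAnn_def)

text \<open>The double co-annihilator is a closure operator, so an intersection of closed sets is
  closed. Intersecting with the carrier gives the empty family its correct value.\<close>

lemma CoAnn_Inter:
  assumes "\<F> \<subseteq> CoAnn A"
  shows "carrier A \<inter> \<Inter>\<F> \<in> CoAnn A"
  unfolding CoAnn_iff
proof (intro conjI equalityI)
  show "coann A (coann A (carrier A \<inter> \<Inter>\<F>)) \<subseteq> carrier A \<inter> \<Inter>\<F>"
  proof (intro Int_greatest Inter_greatest coann_subset)
    fix F
    assume F: "F \<in> \<F>"
    then have "coann A (coann A (carrier A \<inter> \<Inter>\<F>)) \<subseteq> coann A (coann A F)"
      by (intro coann_antimono) blast
    moreover have "coann A (coann A F) = F"
      using F assms CoAnn_iff by blast
    ultimately show "coann A (coann A (carrier A \<inter> \<Inter>\<F>)) \<subseteq> F"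
      by simp
  qed
qed (auto intro!: subset_coann_coann)

lemma CoAnn_Int: "C \<in> CoAnn A \<Longrightarrow> D \<in> CoAnn A \<Longrightarrow> C \<inter> D \<in> CoAnn A"
  using CoAnn_Inter[of "{C, D}"] CoAnn_iff by (simp add: Int_absorb1 le_infI1)

lemma CoAnn_subset: "C \<in> CoAnn A \<Longrightarrow> C \<subseteq> carrier A"
  by (simp add: CoAnn_iff)

lemma rl_filter_CoAnn: "C \<in> CoAnn A \<Longrightarrow> rl_filter A C"
  by (metis CoAnn_iff coann_subset rl_filter_coann)

lemma CoAnn_one: "C \<in> CoAnn A \<Longrightarrow> \<one> \<in> C"
  by (simp add: rl_filter_CoAnn rl_filter_one)

lemma CoAnn_closed: "C \<in> CoAnn A \<Longrightarrow> x \<in> C \<Longrightarrow> x \<in> carrier A"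
  unfolding CoAnn_iff by blast

lemma CoAnn_join_mem:
  assumes "C \<in> CoAnn A" "c \<in> C" "x \<in> carrier A"
  shows "c \<^bold>\<or> x \<in> C" and "x \<^bold>\<or> c \<in> C"
proof -
  have c: "c \<in> carrier A"
    using assms CoAnn_closed by simp
  show "c \<^bold>\<or> x \<in> C"
    using rl_filter_up[OF rl_filter_CoAnn[OF assms(1)] assms(2) le_join1[OF c assms(3)]] assms c join_closed
    by simp
  then show "x \<^bold>\<or> c \<in> C"
    using assms c by (simp add: join_comm[of x c])
qed

text \<open>A co-annihilator is everything iff it contains \<zero>, and joining with \<zero> changes
  nothing, so the set being annihilated must be \<open>{\<one>}\<close>. This turns a join in
  \<open>CoAnn A\<close> into a test for equality with \<one>.\<close>

lemma CoAnn_join_eq_carrier_iff: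
  assumes "\<F> \<subseteq> CoAnn A"
  shows "CoAnn_join A \<F> = carrier A \<longleftrightarrow>
    (\<forall>a\<in>carrier A. (\<forall>F\<in>\<F>. \<forall>c\<in>F. a \<^bold>\<or> c = \<one>) \<longrightarrow> a = \<one>)"
proof -
  define S where "S = carrier A \<inter> (\<Inter>F\<in>\<F>. coann A F)"
  have S: "a \<in> S \<longleftrightarrow> a \<in> carrier A \<and> (\<forall>F\<in>\<F>. \<forall>c\<in>F. a \<^bold>\<or> c = \<one>)" for a
    by (auto simp: S_def mem_coann_iff)
  have "coann A S = carrier A \<longleftrightarrow> (\<forall>a\<in>S. a = \<one>)"
  proof
    assume "coann A S = carrier A"
    then have "\<forall>a\<in>S. \<zero> \<^bold>\<or> a = \<one>"
      using zero_closed mem_coann_iff by blast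
    then show "\<forall>a\<in>S. a = \<one>"
      using S join_zero_left by simp
  next
    assume "\<forall>a\<in>S. a = \<one>"
    then have "x \<in> coann A S" if "x \<in> carrier A" for x
      using that by (metis mem_coann_iff join_one_right)
    then show "coann A S = carrier A"
      using coann_subset by blast
  qed
  then show ?thesis
    using S by (auto simp: CoAnn_join_def S_def[symmetric])
qed

section \<open>Finite partitions: disjointness, density, refinement\<close>

lemma finite_partitionsI:
  assumes "finite \<C>" "\<C> \<subseteq> CoAnn A - {{\<one>}}"
    and "\<And>C D. C \<in> \<C> \<Longrightarrow> D \<in> \<C> \<Longrightarrow> C \<noteq> D \<Longrightarrow> C \<inter> D \<subseteq> {\<one>}"
    and "\<And>a. a \<in> carrier A \<Longrightarrow> (\<And>C c. C \<in> \<C> \<Longrightarrow> c \<in> C \<Longrightarrow> a \<^bold>\<or> c = \<one>) \<Longrightarrow> a = \<one>"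
  shows "\<C> \<in> finite_partitions A"
proof -
  have "C \<inter> D = {\<one>}" if "C \<in> \<C>" "D \<in> \<C>" "C \<noteq> D" for C D
    using assms(3)[OF that] CoAnn_one[of C] CoAnn_one[of D] assms(2) that by blast
  moreover have "CoAnn_join A \<C> = carrier A"
    using assms(2,4) by (subst CoAnn_join_eq_carrier_iff) auto
  ultimately show ?thesis
    using assms(1,2) by (simp add: finite_partitions_def)
qed

lemma finite_partitions_CoAnn: "\<C> \<in> finite_partitions A \<Longrightarrow> C \<in> \<C> \<Longrightarrow> C \<in> CoAnn A"
  by (auto simp: finite_partitions_def)

lemma finite_partitions_Int:
  "\<C> \<in> finite_partitions A \<Longrightarrow> C \<in> \<C> \<Longrightarrow> D \<in> \<C> \<Longrightarrow> C \<noteq> D \<Longrightarrow> C \<inter> D = {\<one>}"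
  by (simp add: finite_partitions_def)

lemma finite_partitions_closed: "\<C> \<in> finite_partitions A \<Longrightarrow> C \<in> \<C> \<Longrightarrow> c \<in> C \<Longrightarrow> c \<in> carrier A"
  using finite_partitions_CoAnn CoAnn_closed by blast

text \<open>The join lies above both elements, hence in both filters, whose intersection is
  trivial.\<close>

lemma finite_partitions_disjoint:
  assumes "\<C> \<in> finite_partitions A" "C \<in> \<C>" "D \<in> \<C>" "C \<noteq> D" "c \<in> C" "d \<in> D"
  shows "c \<^bold>\<or> d = \<one>"
proof -
  have "c \<^bold>\<or> d \<in> C \<inter> D"
    using assms by (meson IntI CoAnn_join_mem finite_partitions_CoAnn finite_partitions_closed)
  moreover have "C \<inter> D = {\<one>}"
    using assms finite_partitions_Int by simp
  ultimately show ?thesis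
    by simp
qed

lemma finite_partitions_dense:
  assumes "\<C> \<in> finite_partitions A" "a \<in> carrier A"
    and "\<And>C c. C \<in> \<C> \<Longrightarrow> c \<in> C \<Longrightarrow> a \<^bold>\<or> c = \<one>"
  shows "a = \<one>"
  using assms CoAnn_join_eq_carrier_iff[of \<C>] by (auto simp: finite_partitions_def)

lemma finite_partitions_coarser_unique:
  assumes "\<C> \<in> finite_partitions A" "\<D> \<in> finite_partitions A" "D \<in> \<D>"
    "C \<in> \<C>" "D \<subseteq> C" "C' \<in> \<C>" "D \<subseteq> C'"
  shows "C = C'"
proof (rule ccontr)
  assume "C \<noteq> C'"
  then have "C \<inter> C' = {\<one>}"
    using assms finite_partitions_Int by simp
  then have "D = {\<one>}"
    using assms CoAnn_one[OF finite_partitions_CoAnn[OF assms(2,3)]] by blast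
  then show False
    using assms(2,3) by (auto simp: finite_partitions_def)
qed

text \<open>The description is the one inside \<open>partition_map\<close>, so the transition maps
  can be rewritten in terms of it.\<close>

definition coarser :: "'a set set \<Rightarrow> 'a set \<Rightarrow> 'a set"
  where "coarser \<C> D = (THE C. C \<in> \<C> \<and> D \<subseteq> C)"

lemma coarser_eq:
  assumes "\<C> \<in> finite_partitions A" "\<D> \<in> finite_partitions A" "D \<in> \<D>" "C \<in> \<C>" "D \<subseteq> C"
  shows "coarser \<C> D = C"
  unfolding coarser_def using assms finite_partitions_coarser_unique by (intro the_equality) blast+

lemma coarser:
  assumes "\<C> \<in> finite_partitions A" "\<D> \<in> finite_partitions A" "refined_by \<C> \<D>" "D \<in> \<D>"
  shows "coarser \<C> D \<in> \<C>" "D \<subseteq> coarser \<C> D"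
proof -
  obtain C where "C \<in> \<C>" "D \<subseteq> C"
    using assms by (auto simp: refined_by_def)
  then show "coarser \<C> D \<in> \<C>" "D \<subseteq> coarser \<C> D"
    using coarser_eq[OF assms(1,2,4)] by simp_all
qed

lemma Int_coann_subset:
  assumes "G \<subseteq> carrier A"
  shows "G \<inter> coann A G \<subseteq> {\<one>}"
proof
  fix g
  assume "g \<in> G \<inter> coann A G"
  then have "g \<in> carrier A" "g \<^bold>\<or> g = \<one>"
    by (simp_all add: mem_coann_iff)
  then show "g \<in> {\<one>}"
    by (simp add: join_idem)
qed

text \<open>An element joining to \<one> with all of \<open>G\<close> lies in
  \<open>coann A G\<close>, and so joins to \<one> with itself. Removing \<open>{\<one>}\<close>
  covers the cases where one side is trivial.\<close>

lemma complementary_partition: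
  assumes "G \<in> CoAnn A"
  shows "{G, coann A G} - {{\<one>}} \<in> finite_partitions A"
proof (rule finite_partitionsI)
  have G: "G \<subseteq> carrier A"
    using assms by (simp add: CoAnn_iff)
  show "{G, coann A G} - {{\<one>}} \<subseteq> CoAnn A - {{\<one>}}"
    using assms coann_in_CoAnn[OF G] by blast
  show "C \<inter> D \<subseteq> {\<one>}" if "C \<in> {G, coann A G} - {{\<one>}}" "D \<in> {G, coann A G} - {{\<one>}}" "C \<noteq> D" for C D
    using that Int_coann_subset[OF G] by auto
  fix a
  assume a: "a \<in> carrier A" "\<And>C c. C \<in> {G, coann A G} - {{\<one>}} \<Longrightarrow> c \<in> C \<Longrightarrow> a \<^bold>\<or> c = \<one>"
  \<comment> \<open>A removed block \<open>{\<one>}\<close> imposes no condition, so the hypothesis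
    extends to both original sets.\<close>
  have *: "a \<^bold>\<or> c = \<one>" if "C \<in> {G, coann A G}" "c \<in> C" for C c
    using a(1) a(2)[of C c] that join_one_right by (cases "C = {\<one>}") auto
  then have "a \<in> coann A G"
    using a by (auto simp: mem_coann_iff)
  then show "a = \<one>"
    using *[of "coann A G" a] join_idem a(1) by simp
qed simp

text \<open>The common refinement consists of the nontrivial pairwise intersections. Its density
  follows from using density twice: over \<C> for \<open>a\<close>, and over \<D> for
  \<open>a \<or> c\<close>, because \<open>c \<or> d\<close> lies in
  \<open>C \<inter> D\<close>.\<close>

lemma finite_partitions_directed:
  assumes "\<C> \<in> finite_partitions A" "\<D> \<in> finite_partitions A"
  shows "\<exists>\<E>\<in>finite_partitions A. refined_by \<C> \<E> \<and> refined_by \<D> \<E>"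
proof (intro bexI conjI)
  let ?\<E> = "(\<lambda>(C, D). C \<inter> D) ` (\<C> \<times> \<D>) - {{\<one>}}"
  show "refined_by \<C> ?\<E>" "refined_by \<D> ?\<E>"
    by (auto simp: refined_by_def)
  show "?\<E> \<in> finite_partitions A"
  proof (rule finite_partitionsI)
    show "finite ?\<E>"
      using assms by (simp add: finite_partitions_def)
    show "?\<E> \<subseteq> CoAnn A - {{\<one>}}"
      using assms by (auto simp: finite_partitions_CoAnn intro!: CoAnn_Int)
    show "E \<inter> E' \<subseteq> {\<one>}" if EE': "E \<in> ?\<E>" "E' \<in> ?\<E>" "E \<noteq> E'" for E E'
    proof -
      obtain C D where CD: "E = C \<inter> D" "C \<in> \<C>" "D \<in> \<D>"
        using EE'(1) by (auto simp: image_iff)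
      obtain C' D' where CD': "E' = C' \<inter> D'" "C' \<in> \<C>" "D' \<in> \<D>"
        using EE'(2) by (auto simp: image_iff)
      have "C \<noteq> C' \<or> D \<noteq> D'"
        using EE'(3) CD(1) CD'(1) by blast
      then have "C \<inter> C' = {\<one>} \<or> D \<inter> D' = {\<one>}"
        using finite_partitions_Int[OF assms(1) CD(2) CD'(2)] finite_partitions_Int[OF assms(2) CD(3) CD'(3)]
        by blast
      then show ?thesis
        unfolding CD(1) CD'(1) by (elim disjE) auto
    qed
    fix a
    assume a: "a \<in> carrier A" and E: "\<And>E e. E \<in> ?\<E> \<Longrightarrow> e \<in> E \<Longrightarrow> a \<^bold>\<or> e = \<one>"
    show "a = \<one>"
    proof (rule finite_partitions_dense[OF assms(1) a])
      fix C c
      assume c: "C \<in> \<C>" "c \<in> C"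
      then have c_A: "c \<in> carrier A"
        using assms finite_partitions_closed by blast
      show "a \<^bold>\<or> c = \<one>"
      proof (rule finite_partitions_dense[OF assms(2)])
        fix D d
        assume d: "D \<in> \<D>" "d \<in> D"
        then have d_A: "d \<in> carrier A"
          using assms finite_partitions_closed by blast
        have cd: "c \<^bold>\<or> d \<in> C \<inter> D"
          using c d c_A d_A assms finite_partitions_CoAnn CoAnn_join_mem by blast
        have "a \<^bold>\<or> (c \<^bold>\<or> d) = \<one>"
        proof (cases "C \<inter> D = {\<one>}")
          case True
          then show ?thesis
            using cd a join_one_right by simp
        next
          case False
          then have "C \<inter> D \<in> ?\<E>"
            using c d by auto
          from E[OF this cd] show ?thesis .
        qed
        then show "(a \<^bold>\<or> c) \<^bold>\<or> d = \<one>"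
          using a c_A d_A by (simp add: join_assoc)
      qed (use a c_A join_closed in simp)
    qed
  qed
qed

lemma rl_filter_coann_partition:
  "\<C> \<in> finite_partitions A \<Longrightarrow> C \<in> \<C> \<Longrightarrow> rl_filter A (coann A C)"
  by (intro rl_filter_coann CoAnn_subset finite_partitions_CoAnn)


section \<open>The inductive system of partition products\<close>

text \<open>Presents members of the product by representatives in \<open>A\<close>, so that
  operations and transition maps can be computed on elements of \<open>A\<close>.\<close>

definition tuple :: "'a set set \<Rightarrow> ('a set \<Rightarrow> 'a) \<Rightarrow> 'a set \<Rightarrow> 'a set"
  where "tuple \<C> a = (\<lambda>C\<in>\<C>. rl_class A (coann A C) (a C))"

lemma tuple_cong: "(\<And>C. C \<in> \<C> \<Longrightarrow> a C = b C) \<Longrightarrow> tuple \<C> a = tuple \<C> b"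
  by (simp add: tuple_def cong: restrict_cong)

lemma tuple_closed:
  "(\<And>C. C \<in> \<C> \<Longrightarrow> a C \<in> carrier A) \<Longrightarrow> tuple \<C> a \<in> carrier (partition_product A \<C>)"
  by (simp add: tuple_def partition_product_def rl_product_def carrier_rl_quotient PiE_iff)

lemma tuple_cases:
  assumes "u \<in> carrier (partition_product A \<C>)"
  obtains a where "\<And>C. C \<in> \<C> \<Longrightarrow> a C \<in> carrier A" "u = tuple \<C> a"
proof -
  have u: "u \<in> extensional \<C>" "\<And>C. C \<in> \<C> \<Longrightarrow> u C \<in> rl_class A (coann A C) ` carrier A"
    using assms by (auto simp: partition_product_def rl_product_def carrier_rl_quotient PiE_iff)
  then have "\<forall>C\<in>\<C>. \<exists>a. a \<in> carrier A \<and> u C = rl_class A (coann A C) a"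
    by (simp add: image_iff Bex_def)
  then obtain a where a: "\<forall>C\<in>\<C>. a C \<in> carrier A \<and> u C = rl_class A (coann A C) (a C)"
    using bchoice by meson
  then have "u = tuple \<C> a"
    using u(1) by (auto simp: tuple_def intro!: extensionalityI[of u \<C>])
  with a show thesis
    by (intro that) auto
qed

lemma tuple_ops:
  assumes \<C>: "\<C> \<in> finite_partitions A"
    and a: "\<And>C. C \<in> \<C> \<Longrightarrow> a C \<in> carrier A" and b: "\<And>C. C \<in> \<C> \<Longrightarrow> b C \<in> carrier A"
  shows "tuple \<C> a \<otimes>\<^bsub>partition_product A \<C>\<^esub> tuple \<C> b = tuple \<C> (\<lambda>C. a C \<otimes> b C)"
    and "tuple \<C> a \<^bold>\<or>\<^bsub>partition_product A \<C>\<^esub> tuple \<C> b = tuple \<C> (\<lambda>C. a C \<^bold>\<or> b C)"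
    and "tuple \<C> a \<^bold>\<and>\<^bsub>partition_product A \<C>\<^esub> tuple \<C> b = tuple \<C> (\<lambda>C. a C \<^bold>\<and> b C)"
    and "tuple \<C> a \<^bold>\<rightarrow>\<^bsub>partition_product A \<C>\<^esub> tuple \<C> b = tuple \<C> (\<lambda>C. a C \<^bold>\<rightarrow> b C)"
  using rl_homD(2-5)[OF rl_class_hom[OF rl_filter_coann_partition[OF \<C>]]] a b
  by (simp_all add: tuple_def partition_product_def rl_product_def cong: restrict_cong)

lemma tuple_bounds:
  assumes \<C>: "\<C> \<in> finite_partitions A"
  shows "\<one>\<^bsub>partition_product A \<C>\<^esub> = tuple \<C> (\<lambda>_. \<one>)"
    and "\<zero>\<^bsub>partition_product A \<C>\<^esub> = tuple \<C> (\<lambda>_. \<zero>)"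
  by (simp_all add: tuple_def partition_product_def rl_product_def rl_quotient_def)

lemma tuple_eq_one_iff:
  assumes "\<C> \<in> finite_partitions A" and "\<And>C. C \<in> \<C> \<Longrightarrow> a C \<in> carrier A"
  shows "tuple \<C> a = \<one>\<^bsub>partition_product A \<C>\<^esub> \<longleftrightarrow> (\<forall>C\<in>\<C>. a C \<in> coann A C)"
  using rl_class_eq_one_iff[OF rl_filter_coann_partition[OF assms(1)]] assms(2)
  by (auto simp: tuple_bounds[OF assms(1)] tuple_def fun_eq_iff restrict_def)

lemma residuated_lattice_partition_product:
  "\<C> \<in> finite_partitions A \<Longrightarrow> residuated_lattice (partition_product A \<C>)"
  unfolding partition_product_def
  by (intro residuated_lattice_product residuated_lattice_quotient rl_filter_coann_partition)

text \<open>From \<open>D \<subseteq> C\<close> the filter \<open>coann A D\<close> is the larger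
  one, so a class modulo \<open>coann A C\<close> sits inside one class modulo
  \<open>coann A D\<close> and any representative may be used.\<close>

lemma partition_map_tuple:
  assumes \<C>: "\<C> \<in> finite_partitions A" and \<D>: "\<D> \<in> finite_partitions A" and "refined_by \<C> \<D>"
    and a: "\<And>C. C \<in> \<C> \<Longrightarrow> a C \<in> carrier A"
  shows "partition_map A \<C> \<D> (tuple \<C> a) = tuple \<D> (\<lambda>D. a (coarser \<C> D))"
proof -
  have "(\<Union>x\<in>tuple \<C> a (coarser \<C> D). rl_class A (coann A D) x) = rl_class A (coann A D) (a (coarser \<C> D))"
    if D: "D \<in> \<D>" for D
  proof -
    define C where "C = coarser \<C> D"
    have C: "C \<in> \<C>" "D \<subseteq> C"
      using coarser[OF assms(1-3) D] by (simp_all add: C_def)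
    note filters = rl_filter_coann_partition[OF \<C> C(1)] rl_filter_coann_partition[OF \<D> D]
    have eq: "rl_class A (coann A D) x = rl_class A (coann A D) (a C)" if "x \<in> rl_class A (coann A C) (a C)" for x
    proof -
      have "(a C, x) \<in> filter_cong A (coann A D)"
        using that coann_antimono[OF C(2)] by (auto simp: rl_class_def filter_cong_def)
      then have "rl_class A (coann A D) (a C) = rl_class A (coann A D) x"
        unfolding rl_class_def by (rule equiv_class_eq[OF equiv_filter_cong[OF filters(2)]])
      then show ?thesis ..
    qed
    have "rl_class A (coann A C) (a C) \<noteq> {}"
      using rl_class_self[OF filters(1) a[OF C(1)]] by auto
    from SUP_eq_const[OF this eq]
    have "(\<Union>x\<in>rl_class A (coann A C) (a C). rl_class A (coann A D) x) = rl_class A (coann A D) (a C)" .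
    moreover have "tuple \<C> a C = rl_class A (coann A C) (a C)"
      using C by (simp add: tuple_def)
    ultimately show ?thesis
      unfolding C_def[symmetric] by simp
  qed
  then show ?thesis
    unfolding partition_map_def tuple_def[of \<D>] coarser_def[symmetric] by (rule restrict_ext)
qed

lemma partition_inductive_system:
  "inductive_system (finite_partitions A) refined_by (partition_product A) (partition_map A)"
proof (rule inductive_system.intro)
  show "finite_partitions A \<noteq> {}"
    using complementary_partition[OF coann_in_CoAnn[of "{}"]] by auto
  show "refined_by \<C> \<E>" if "refined_by \<C> \<D>" "refined_by \<D> \<E>" for \<C> \<D> \<E> :: "'a set set"
    using that unfolding refined_by_def by (meson order_trans)
  show "partition_map A \<C> \<D> \<in> rl_hom (partition_product A \<C>) (partition_product A \<D>)"
    if part: "\<C> \<in> finite_partitions A" "\<D> \<in> finite_partitions A" "refined_by \<C> \<D>" for \<C> \<D>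
  proof -
    let ?h = "partition_map A \<C> \<D>" and ?P = "partition_product A \<C>" and ?Q = "partition_product A \<D>"
    note coarser_in = coarser(1)[OF part]
    have "?h u \<in> carrier ?Q \<and> ?h (u \<otimes>\<^bsub>?P\<^esub> v) = ?h u \<otimes>\<^bsub>?Q\<^esub> ?h v \<and> ?h (u \<^bold>\<or>\<^bsub>?P\<^esub> v) = ?h u \<^bold>\<or>\<^bsub>?Q\<^esub> ?h v \<and>
      ?h (u \<^bold>\<and>\<^bsub>?P\<^esub> v) = ?h u \<^bold>\<and>\<^bsub>?Q\<^esub> ?h v \<and> ?h (u \<^bold>\<rightarrow>\<^bsub>?P\<^esub> v) = ?h u \<^bold>\<rightarrow>\<^bsub>?Q\<^esub> ?h v"
      if uv: "u \<in> carrier ?P" "v \<in> carrier ?P" for u v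
    proof -
      obtain a where "\<And>C. C \<in> \<C> \<Longrightarrow> a C \<in> carrier A" "u = tuple \<C> a"
        by (rule tuple_cases[OF uv(1)]) blast
      moreover obtain b where "\<And>C. C \<in> \<C> \<Longrightarrow> b C \<in> carrier A" "v = tuple \<C> b"
        by (rule tuple_cases[OF uv(2)]) blast
      ultimately show ?thesis
        using part coarser_in
        by (simp add: tuple_ops partition_map_tuple tuple_closed join_closed meet_closed imp_closed)
    qed
    moreover have "?h \<one>\<^bsub>?P\<^esub> = \<one>\<^bsub>?Q\<^esub>" "?h \<zero>\<^bsub>?P\<^esub> = \<zero>\<^bsub>?Q\<^esub>"
      using part by (simp_all add: tuple_bounds partition_map_tuple zero_closed)
    ultimately show ?thesis
      by (simp add: rl_hom_def Pi_iff)
  qed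
  show "partition_map A \<D> \<E> (partition_map A \<C> \<D> u) = partition_map A \<C> \<E> u"
    if part: "\<C> \<in> finite_partitions A" "\<D> \<in> finite_partitions A" "\<E> \<in> finite_partitions A"
      and ref: "refined_by \<C> \<D>" "refined_by \<D> \<E>" and u: "u \<in> carrier (partition_product A \<C>)"
    for \<C> \<D> \<E> u
  proof -
    obtain a where a: "\<And>C. C \<in> \<C> \<Longrightarrow> a C \<in> carrier A" "u = tuple \<C> a"
      by (rule tuple_cases[OF u]) blast
    have "refined_by \<C> \<E>"
      using ref unfolding refined_by_def by (meson order_trans)
    \<comment> \<open>Compatibility of the transition maps rests on uniqueness of the block above:
      climbing through \<D> also reaches a block of \<C> containing \<open>E\<close>.\<close>
    moreover have "coarser \<C> (coarser \<D> E) = coarser \<C> E" if "E \<in> \<E>" for E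
    proof (rule coarser_eq[symmetric, OF part(1,3) that])
      note D = coarser[OF part(2,3) ref(2) that]
      show "coarser \<C> (coarser \<D> E) \<in> \<C>" "E \<subseteq> coarser \<C> (coarser \<D> E)"
        using coarser[OF part(1,2) ref(1) D(1)] D(2) by auto
    qed
    ultimately show ?thesis
      using a part ref coarser[OF part(1,2) ref(1)]
      by (simp add: partition_map_tuple cong: tuple_cong)
  qed
qed (simp_all add: finite_partitions_directed residuated_lattice_partition_product)

end

text \<open>Complements multiply to \<zero>, because the product lies below the meet. So
  \<open>y \<or> f = \<one>\<close> gives
  \<open>e = e \<otimes> (y \<or> f) = e \<otimes> y\<close>, whence \<open>e\<close> is the least
  element of \<open>coann A {f}\<close>.\<close>

lemma (in residuated_lattice) coann_complement_eq_principal_filter: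
  assumes e: "e \<in> carrier A" and f: "f \<in> carrier A" and "e \<^bold>\<or> f = \<one>" "e \<^bold>\<and> f = \<zero>"
  shows "coann A {f} = principal_filter A e"
proof (rule equalityI)
  have "e \<otimes> f \<^bold>\<le> \<zero>"
    using meet_greatest[OF e f m_closed[OF e f] mult_le1[OF e f] mult_le2[OF e f]] assms by simp
  then have ef: "e \<otimes> f = \<zero>"
    using e f le_antisym zero_least zero_closed by simp
  have e_le: "e \<^bold>\<le> y" if y: "y \<in> carrier A" "y \<^bold>\<or> f = \<one>" for y
  proof -
    have "e = e \<otimes> (y \<^bold>\<or> f)"
      using e y by simp
    also have "\<dots> = (e \<otimes> y) \<^bold>\<or> \<zero>"
      using e f y(1) by (simp only: mult_join_distrib ef)
    also have "\<dots> = e \<otimes> y"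
      using e y(1) by (simp add: join_zero_right)
    finally show ?thesis
      using mult_le2[OF e y(1)] by simp
  qed
  show "coann A {f} \<subseteq> principal_filter A e"
    using e_le rl_filter_up by (auto simp: principal_filter_def mem_coann_iff)
  have "rl_filter A (coann A {f})" "e \<in> coann A {f}"
    using assms by (simp_all add: rl_filter_coann mem_coann_iff)
  then show "principal_filter A e \<subseteq> coann A {f}"
    by (auto simp: principal_filter_def)
qed


section \<open>The strongly co-Stone hull\<close>

text \<open>A locale of its own, without further assumptions: interpreting the hull inside
  \<open>residuated_lattice\<close> would entail the hull of the hull, and so on without
  end.\<close>

locale co_Stone_hull = residuated_lattice
begin

sublocale sys: inductive_system "finite_partitions A" refined_by "partition_product A" "partition_map A"
  by (rule partition_inductive_system)

abbreviation H where "H \<equiv> strongly_co_Stone_hull A"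

lemma H_dirlim: "H = dirlim (finite_partitions A) refined_by (partition_product A) (partition_map A)"
  by (simp add: strongly_co_Stone_hull_def)

sublocale H: residuated_lattice H
  unfolding H_dirlim by (rule sys.residuated_lattice_dirlim)

section \<open>Elements of the hull through representatives in \<open>A\<close>\<close>

definition elt :: "'a set set \<Rightarrow> ('a set \<Rightarrow> 'a) \<Rightarrow> ('a set set \<times> ('a set \<Rightarrow> 'a set)) set"
  where "elt \<C> a = sys.germ \<C> (tuple \<C> a)"

lemma elt_closed:
  assumes "\<C> \<in> finite_partitions A" "\<And>C. C \<in> \<C> \<Longrightarrow> a C \<in> carrier A"
  shows "elt \<C> a \<in> carrier H"
  unfolding elt_def H_dirlim
  using rl_homD(1)[OF sys.germ_hom[OF assms(1)] tuple_closed[OF assms(2)]] .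

lemma elt_join_meet:
  assumes \<C>: "\<C> \<in> finite_partitions A"
    and a: "\<And>C. C \<in> \<C> \<Longrightarrow> a C \<in> carrier A" and b: "\<And>C. C \<in> \<C> \<Longrightarrow> b C \<in> carrier A"
  shows "elt \<C> a \<^bold>\<or>\<^bsub>H\<^esub> elt \<C> b = elt \<C> (\<lambda>C. a C \<^bold>\<or> b C)"
    and "elt \<C> a \<^bold>\<and>\<^bsub>H\<^esub> elt \<C> b = elt \<C> (\<lambda>C. a C \<^bold>\<and> b C)"
  using rl_homD(3,4)[OF sys.germ_hom[OF \<C>] tuple_closed[OF a] tuple_closed[OF b]] assms
  by (simp_all add: elt_def H_dirlim tuple_ops)

lemma elt_bounds:
  assumes \<C>: "\<C> \<in> finite_partitions A"
  shows "elt \<C> (\<lambda>_. \<one>) = \<one>\<^bsub>H\<^esub>" and "elt \<C> (\<lambda>_. \<zero>) = \<zero>\<^bsub>H\<^esub>"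
  using rl_homD(6,7)[OF sys.germ_hom[OF \<C>]] tuple_bounds[OF \<C>]
  by (simp_all add: elt_def H_dirlim)

lemma elt_cases:
  assumes "x \<in> carrier H"
  obtains \<C> a where "\<C> \<in> finite_partitions A" "\<And>C. C \<in> \<C> \<Longrightarrow> a C \<in> carrier A" "x = elt \<C> a"
proof -
  obtain \<C> u where \<C>: "\<C> \<in> finite_partitions A" and u: "u \<in> carrier (partition_product A \<C>)"
    and x: "x = sys.germ \<C> u"
    by (rule sys.dirlim_cases[OF assms[unfolded H_dirlim]])
  obtain a where "\<And>C. C \<in> \<C> \<Longrightarrow> a C \<in> carrier A" "u = tuple \<C> a"
    by (rule tuple_cases[OF u]) blast
  with \<C> x show thesis
    by (intro that) (auto simp: elt_def)
qed

lemma elt_cases2: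
  assumes "x \<in> carrier H" "y \<in> carrier H"
  obtains \<C> a b where "\<C> \<in> finite_partitions A" "\<And>C. C \<in> \<C> \<Longrightarrow> a C \<in> carrier A"
    "\<And>C. C \<in> \<C> \<Longrightarrow> b C \<in> carrier A" "x = elt \<C> a" "y = elt \<C> b"
proof -
  obtain \<C> u v where \<C>: "\<C> \<in> finite_partitions A" and u: "u \<in> carrier (partition_product A \<C>)"
    and v: "v \<in> carrier (partition_product A \<C>)" and xy: "x = sys.germ \<C> u" "y = sys.germ \<C> v"
    by (rule sys.dirlim_cases2[OF assms[unfolded H_dirlim]])
  obtain a where a: "\<And>C. C \<in> \<C> \<Longrightarrow> a C \<in> carrier A" "u = tuple \<C> a"
    by (rule tuple_cases[OF u]) blast
  obtain b where "\<And>C. C \<in> \<C> \<Longrightarrow> b C \<in> carrier A" "v = tuple \<C> b"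
    by (rule tuple_cases[OF v]) blast
  with a \<C> xy show thesis
    by (intro that) (auto simp: elt_def)
qed

lemma elt_refine:
  assumes "\<C> \<in> finite_partitions A" "\<D> \<in> finite_partitions A" "refined_by \<C> \<D>"
    and "\<And>C. C \<in> \<C> \<Longrightarrow> a C \<in> carrier A"
  shows "elt \<D> (\<lambda>D. a (coarser \<C> D)) = elt \<C> a"
  unfolding elt_def
  using sys.germ_f[OF assms(1-3) tuple_closed[OF assms(4)]] partition_map_tuple[OF assms] by simp

text \<open>Equality in the limit is witnessed only over some refinement \<D>. Density of \<D>
  carries it back to \<C>; this is injectivity of the transition maps at the unit.\<close>

lemma elt_eq_one_iff:
  assumes \<C>: "\<C> \<in> finite_partitions A" and a: "\<And>C. C \<in> \<C> \<Longrightarrow> a C \<in> carrier A"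
  shows "elt \<C> a = \<one>\<^bsub>H\<^esub> \<longleftrightarrow> (\<forall>C\<in>\<C>. a C \<in> coann A C)"
proof
  assume "\<forall>C\<in>\<C>. a C \<in> coann A C"
  then have "tuple \<C> a = tuple \<C> (\<lambda>_. \<one>)"
    using tuple_eq_one_iff[OF \<C>, of a] a by (simp add: tuple_bounds[OF \<C>])
  then show "elt \<C> a = \<one>\<^bsub>H\<^esub>"
    using elt_bounds(1)[OF \<C>] by (simp add: elt_def)
next
  assume "elt \<C> a = \<one>\<^bsub>H\<^esub>"
  then have "sys.germ \<C> (tuple \<C> a) = sys.germ \<C> (tuple \<C> (\<lambda>_. \<one>))"
    using elt_bounds(1)[OF \<C>] by (simp add: elt_def)
  moreover have "tuple \<C> (\<lambda>_. \<one>) \<in> carrier (partition_product A \<C>)"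
    "tuple \<C> a \<in> carrier (partition_product A \<C>)"
    using a by (simp_all add: tuple_closed)
  ultimately obtain \<D> where \<D>: "\<D> \<in> finite_partitions A" "refined_by \<C> \<D>"
    and eq: "partition_map A \<C> \<D> (tuple \<C> a) = partition_map A \<C> \<D> (tuple \<C> (\<lambda>_. \<one>))"
    using sys.germ_eq_iff[OF \<C> _ \<C>] by blast
  note coarser_\<D> = coarser[OF \<C> \<D>]
  have "tuple \<D> (\<lambda>D. a (coarser \<C> D)) = \<one>\<^bsub>partition_product A \<D>\<^esub>"
    using eq a by (simp add: partition_map_tuple[OF \<C> \<D>] tuple_bounds[OF \<D>(1)])
  then have a_\<D>: "a (coarser \<C> D) \<in> coann A D" if "D \<in> \<D>" for D
    using that a coarser_\<D>(1) by (simp add: tuple_eq_one_iff[OF \<D>(1)])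
  show "\<forall>C\<in>\<C>. a C \<in> coann A C"
  proof
    fix C
    assume C: "C \<in> \<C>"
    have "a C \<^bold>\<or> c = \<one>" if c: "c \<in> C" for c
    proof (rule finite_partitions_dense[OF \<D>(1)])
      have c_A: "c \<in> carrier A"
        using finite_partitions_closed[OF \<C> C c] .
      then show "a C \<^bold>\<or> c \<in> carrier A"
        using a C join_closed by simp
      fix D d
      assume D: "D \<in> \<D>" "d \<in> D"
      have d_A: "d \<in> carrier A"
        using finite_partitions_closed[OF \<D>(1) D] .
      show "(a C \<^bold>\<or> c) \<^bold>\<or> d = \<one>"
      \<comment> \<open>Over a block inside \<open>C\<close> the element \<open>a C\<close> already
        joins to \<one> with \<open>d\<close>; over any other block \<open>c\<close> does, by
        disjointness.\<close>
      proof (cases "coarser \<C> D = C")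
        case True
        then have "a C \<^bold>\<or> d = \<one>"
          using a_\<D>[OF D(1)] D(2) by (simp add: mem_coann_iff)
        moreover have "(a C \<^bold>\<or> c) \<^bold>\<or> d = c \<^bold>\<or> (a C \<^bold>\<or> d)"
          using a[OF C] c_A d_A by (simp add: join_ac join_closed)
        ultimately show ?thesis
          using c_A by (simp add: join_one_right)
      next
        case False
        then have "c \<^bold>\<or> d = \<one>"
          using finite_partitions_disjoint[OF \<C> C coarser_\<D>(1)[OF D(1)] _ c] coarser_\<D>(2)[OF D(1)] D(2)
          by blast
        then show ?thesis
          using a[OF C] c_A d_A by (simp add: join_assoc join_one_right)
      qed
    qed
    then show "a C \<in> coann A C"
      using a[OF C] by (simp add: mem_coann_iff)
  qed
qed

text \<open>The canonical map of \<open>A\<close> into its hull, computed at the coarsest partition, which is \<open>{A}\<close>, or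
  empty if \<open>A\<close> is trivial.\<close>

definition constant_elt :: "'a \<Rightarrow> ('a set set \<times> ('a set \<Rightarrow> 'a set)) set"
  where "constant_elt t = elt ({carrier A, coann A (carrier A)} - {{\<one>}}) (\<lambda>_. t)"

text \<open>Passing to a refinement only reindexes the representatives, so a constant family stays
  constant and can be compared with the base partition over a common refinement.\<close>

lemma elt_eq_constant:
  assumes \<C>: "\<C> \<in> finite_partitions A" and t: "t \<in> carrier A"
  shows "elt \<C> (\<lambda>_. t) = constant_elt t"
proof -
  let ?\<D> = "{carrier A, coann A (carrier A)} - {{\<one>}}"
  have "carrier A = coann A {}"
    by (auto simp: coann_def)
  then have \<D>: "?\<D> \<in> finite_partitions A"
    using complementary_partition[OF coann_in_CoAnn[of "{}"]] by simp
  obtain \<E> where \<E>: "\<E> \<in> finite_partitions A" "refined_by \<C> \<E>" "refined_by ?\<D> \<E>"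
    using finite_partitions_directed[OF \<C> \<D>] by auto
  show ?thesis
    unfolding constant_elt_def
    using elt_refine[OF \<C> \<E>(1,2), of "\<lambda>_. t"] elt_refine[OF \<D> \<E>(1,3), of "\<lambda>_. t"] t by simp
qed

text \<open>The co-annihilator of \<open>x\<close>, pulled back along the embedding of \<open>A\<close> into its hull. It determines
  which elements of the hull join with \<open>x\<close> to the unit.\<close>

definition trace :: "('a set set \<times> ('a set \<Rightarrow> 'a set)) set \<Rightarrow> 'a set"
  where "trace x = {t \<in> carrier A. constant_elt t \<^bold>\<or>\<^bsub>H\<^esub> x = \<one>\<^bsub>H\<^esub>}"

section \<open>Traces as co-annihilators of \<open>A\<close>\<close>

lemma mem_trace_elt_iff:
  assumes \<C>: "\<C> \<in> finite_partitions A" and a: "\<And>C. C \<in> \<C> \<Longrightarrow> a C \<in> carrier A"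
  shows "t \<in> trace (elt \<C> a) \<longleftrightarrow> t \<in> carrier A \<and> (\<forall>C\<in>\<C>. t \<^bold>\<or> a C \<in> coann A C)"
proof (cases "t \<in> carrier A")
  case True
  have "constant_elt t \<^bold>\<or>\<^bsub>H\<^esub> elt \<C> a = elt \<C> (\<lambda>C. t \<^bold>\<or> a C)"
    using elt_join_meet(1)[OF \<C> _ a, of "\<lambda>_. t"] True by (simp add: elt_eq_constant[OF \<C>])
  then show ?thesis
    using True elt_eq_one_iff[OF \<C>, of "\<lambda>C. t \<^bold>\<or> a C"] a by (simp add: trace_def join_closed)
qed (simp add: trace_def)

lemma trace_elt:
  assumes \<C>: "\<C> \<in> finite_partitions A" and a: "\<And>C. C \<in> \<C> \<Longrightarrow> a C \<in> carrier A"
  shows "trace (elt \<C> a) = coann A (\<Union>C\<in>\<C>. (\<lambda>c. a C \<^bold>\<or> c) ` C)"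
proof (rule Set.set_eqI)
  fix t
  have "t \<^bold>\<or> a C \<in> coann A C \<longleftrightarrow> (\<forall>c\<in>C. t \<^bold>\<or> (a C \<^bold>\<or> c) = \<one>)" if "t \<in> carrier A" "C \<in> \<C>" for C
    using that a finite_partitions_closed[OF \<C>] by (simp add: mem_coann_iff join_closed join_assoc)
  then show "t \<in> trace (elt \<C> a) \<longleftrightarrow> t \<in> coann A (\<Union>C\<in>\<C>. (\<lambda>c. a C \<^bold>\<or> c) ` C)"
    by (auto simp: mem_trace_elt_iff[OF assms] mem_coann_iff)
qed

lemma trace_in_CoAnn:
  assumes "x \<in> carrier H"
  shows "trace x \<in> CoAnn A"
proof -
  obtain \<C> a where \<C>: "\<C> \<in> finite_partitions A" and a: "\<And>C. C \<in> \<C> \<Longrightarrow> a C \<in> carrier A" and x: "x = elt \<C> a"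
    using elt_cases[OF assms] by metis
  have "(\<Union>C\<in>\<C>. (\<lambda>c. a C \<^bold>\<or> c) ` C) \<subseteq> carrier A"
    using a finite_partitions_closed[OF \<C>] join_closed by blast
  then show ?thesis
    using trace_elt[OF \<C>, of a] a by (simp add: x coann_in_CoAnn)
qed

text \<open>The inclusion tests joins of all pairs of generators of the two traces, whereas the
  equation in the hull tests only pairs from the same block. The tests agree because members of
  distinct blocks join to \<one>.\<close>

lemma join_eq_one_iff_trace:
  assumes "x \<in> carrier H" "y \<in> carrier H"
  shows "x \<^bold>\<or>\<^bsub>H\<^esub> y = \<one>\<^bsub>H\<^esub> \<longleftrightarrow> coann A (trace x) \<subseteq> trace y"
proof -
  obtain \<C> a b where \<C>: "\<C> \<in> finite_partitions A" and a: "\<And>C. C \<in> \<C> \<Longrightarrow> a C \<in> carrier A"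
    and b: "\<And>C. C \<in> \<C> \<Longrightarrow> b C \<in> carrier A" and xy: "x = elt \<C> a" "y = elt \<C> b"
    using elt_cases2[OF assms] by metis
  note \<C>_A = finite_partitions_closed[OF \<C>]
  have subset: "(\<Union>C\<in>\<C>. (\<lambda>c. a C \<^bold>\<or> c) ` C) \<subseteq> carrier A" "(\<Union>C\<in>\<C>. (\<lambda>c. b C \<^bold>\<or> c) ` C) \<subseteq> carrier A"
    using a b \<C>_A join_closed by blast+
  have "x \<^bold>\<or>\<^bsub>H\<^esub> y = \<one>\<^bsub>H\<^esub> \<longleftrightarrow> (\<forall>C\<in>\<C>. \<forall>c\<in>C. (a C \<^bold>\<or> b C) \<^bold>\<or> c = \<one>)"
    using elt_join_meet(1)[OF \<C>, of a b] elt_eq_one_iff[OF \<C>, of "\<lambda>C. a C \<^bold>\<or> b C"] a b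
    by (simp add: xy mem_coann_iff join_closed)
  also have "\<dots> \<longleftrightarrow> (\<forall>C\<in>\<C>. \<forall>c\<in>C. \<forall>D\<in>\<C>. \<forall>d\<in>D. (a C \<^bold>\<or> c) \<^bold>\<or> (b D \<^bold>\<or> d) = \<one>)"
  proof (intro iffI ballI)
    fix C c D d
    assume *: "\<forall>C\<in>\<C>. \<forall>c\<in>C. (a C \<^bold>\<or> b C) \<^bold>\<or> c = \<one>" and C: "C \<in> \<C>" "c \<in> C" and D: "D \<in> \<C>" "d \<in> D"
    note in_A = a[OF C(1)] b[OF D(1)] \<C>_A[OF C] \<C>_A[OF D]
    show "(a C \<^bold>\<or> c) \<^bold>\<or> (b D \<^bold>\<or> d) = \<one>"
    proof (cases "C = D")
      case True
      have "(a C \<^bold>\<or> c) \<^bold>\<or> (b D \<^bold>\<or> d) = ((a C \<^bold>\<or> b D) \<^bold>\<or> c) \<^bold>\<or> d"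
        using in_A by (simp add: join_ac join_closed)
      then show ?thesis
        using * C True in_A by (simp add: join_one_left)
    next
      case False
      have "(a C \<^bold>\<or> c) \<^bold>\<or> (b D \<^bold>\<or> d) = (a C \<^bold>\<or> b D) \<^bold>\<or> (c \<^bold>\<or> d)"
        using in_A by (simp add: join_ac join_closed)
      then show ?thesis
        using finite_partitions_disjoint[OF \<C> C(1) D(1) False C(2) D(2)] in_A
        by (simp add: join_one_right join_closed)
    qed
  next
    fix C c
    assume *: "\<forall>C\<in>\<C>. \<forall>c\<in>C. \<forall>D\<in>\<C>. \<forall>d\<in>D. (a C \<^bold>\<or> c) \<^bold>\<or> (b D \<^bold>\<or> d) = \<one>" and C: "C \<in> \<C>" "c \<in> C"
    \<comment> \<open>Taking the same block and the same \<open>c\<close> on both sides recovers the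
      componentwise condition.\<close>
    have "(a C \<^bold>\<or> b C) \<^bold>\<or> c = (a C \<^bold>\<or> c) \<^bold>\<or> (b C \<^bold>\<or> c)"
      using a[OF C(1)] b[OF C(1)] \<C>_A[OF C] by (simp add: join_ac join_closed)
    then show "(a C \<^bold>\<or> b C) \<^bold>\<or> c = \<one>"
      using * C by simp
  qed
  also have "\<dots> \<longleftrightarrow> coann A (trace x) \<subseteq> trace y"
    using trace_elt[OF \<C>, of a] trace_elt[OF \<C>, of b] coann_coann_subset_iff[OF subset] a b
    by (simp add: xy)
  finally show ?thesis .
qed

lemma complements_with_trace:
  assumes G: "G \<in> CoAnn A"
  obtains e f where "e \<in> carrier H" "f \<in> carrier H" "e \<^bold>\<or>\<^bsub>H\<^esub> f = \<one>\<^bsub>H\<^esub>" "e \<^bold>\<and>\<^bsub>H\<^esub> f = \<zero>\<^bsub>H\<^esub>" "trace f = G"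
proof -
  define \<C> where "\<C> = {G, coann A G} - {{\<one>}}"
  \<comment> \<open>Any block other than \<open>G\<close> is \<open>coann A G\<close>. On
    \<open>G\<close> the value \<one> of \<open>f\<close> allows every \<open>t\<close>; on
    \<open>coann A G\<close> the value \<zero> requires \<open>t\<close> in
    \<open>coann A (coann A G)\<close>, which is \<open>G\<close>.\<close>
  define e f where "e C = (if C = G then \<zero> else \<one>)" and "f C = (if C = G then \<one> else \<zero>)" for C
  have \<C>: "\<C> \<in> finite_partitions A"
    unfolding \<C>_def using G by (rule complementary_partition)
  have ef: "e C \<in> carrier A" "f C \<in> carrier A" "e C \<^bold>\<or> f C = \<one>" "e C \<^bold>\<and> f C = \<zero>" for C
    using zero_closed by (auto simp: e_def f_def join_one_left join_one_right meet_zero_left meet_zero_right)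
  have GG: "coann A (coann A G) = G" "G \<subseteq> carrier A"
    using G by (simp_all add: CoAnn_iff)
  have "t \<in> trace (elt \<C> f) \<longleftrightarrow> t \<in> G" for t
  proof (cases "t \<in> carrier A")
    case True
    have one: "\<one> \<in> coann A C" if "C \<in> \<C>" for C
      using rl_filter_one[OF rl_filter_coann_partition[OF \<C> that]] .
    have "t \<in> trace (elt \<C> f) \<longleftrightarrow> (\<forall>C\<in>\<C>. t \<^bold>\<or> f C \<in> coann A C)"
      using True ef mem_trace_elt_iff[OF \<C>, of f] by simp
    also have "\<dots> \<longleftrightarrow> (\<forall>C\<in>\<C>. C \<noteq> G \<longrightarrow> t \<in> coann A C)"
      using True one by (auto simp: f_def join_one_right join_zero_right)
    also have "\<dots> \<longleftrightarrow> t \<in> G"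
    proof
      assume *: "\<forall>C\<in>\<C>. C \<noteq> G \<longrightarrow> t \<in> coann A C"
      show "t \<in> G"
      proof (cases "coann A G \<in> \<C> \<and> coann A G \<noteq> G")
        case True
        then show ?thesis
          using * GG by auto
      next
        \<comment> \<open>Here no block restricts \<open>t\<close>, so \<open>G\<close> has to be
          the whole carrier. Either \<open>coann A G\<close> was removed as \<open>{\<one>}\<close>,
          or it coincides with \<open>G\<close> and both are \<open>{\<one>}\<close>.\<close>
        case False
        have "coann A G = {\<one>}"
        proof (cases "coann A G = G")
          case True
          then have "G \<subseteq> {\<one>}"
            using Int_coann_subset[OF GG(2)] by simp
          then show ?thesis
            using True CoAnn_one[OF G] by blast
        qed (use False in \<open>auto simp: \<C>_def\<close>)
        then have "G = coann A {\<one>}"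
          using GG by simp
        then show ?thesis
          using \<open>t \<in> carrier A\<close> by (simp add: mem_coann_iff join_one_right)
      qed
    next
      assume "t \<in> G"
      then show "\<forall>C\<in>\<C>. C \<noteq> G \<longrightarrow> t \<in> coann A C"
        using GG by (auto simp: \<C>_def)
    qed
    finally show ?thesis .
  qed (use GG in \<open>auto simp: trace_def\<close>)
  then have "trace (elt \<C> f) = G"
    by (rule Set.set_eqI)
  moreover have "elt \<C> e \<^bold>\<or>\<^bsub>H\<^esub> elt \<C> f = \<one>\<^bsub>H\<^esub>" "elt \<C> e \<^bold>\<and>\<^bsub>H\<^esub> elt \<C> f = \<zero>\<^bsub>H\<^esub>"
    by (simp_all add: elt_join_meet[OF \<C>] ef elt_bounds[OF \<C>])
  ultimately show thesis
    using elt_closed[OF \<C>] ef by (intro that[of "elt \<C> e" "elt \<C> f"]) simp_all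
qed

lemma strongly_co_Stone_H: "strongly_co_Stone H"
proof
  fix X
  assume X: "X \<subseteq> carrier H"
  \<comment> \<open>The carrier is the value for empty \<open>X\<close>, whose co-annihilator is the
    whole hull.\<close>
  define G where "G = carrier A \<inter> \<Inter>(trace ` X)"
  have "G \<in> CoAnn A"
    unfolding G_def using X trace_in_CoAnn by (intro CoAnn_Inter) auto
  then obtain e f where e: "e \<in> carrier H" and f: "f \<in> carrier H"
    and ef: "e \<^bold>\<or>\<^bsub>H\<^esub> f = \<one>\<^bsub>H\<^esub>" "e \<^bold>\<and>\<^bsub>H\<^esub> f = \<zero>\<^bsub>H\<^esub>" and trace_f: "trace f = G"
    by (rule complements_with_trace)
  have "y \<in> coann H X \<longleftrightarrow> y \<in> coann H {f}" for y
  proof (cases "y \<in> carrier H")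
    case True
    \<comment> \<open>With \<open>y\<close> as the first argument of the trace criterion,
      \<open>x\<close> enters only through \<open>trace x\<close> on the right of the inclusion, so
      the next step can absorb all conditions into one intersection, whatever the size of
      \<open>X\<close>.\<close>
    then have "y \<in> coann H X \<longleftrightarrow> (\<forall>x\<in>X. coann A (trace y) \<subseteq> trace x)"
      using X join_eq_one_iff_trace[OF True] by (auto simp: H.mem_coann_iff)
    also have "\<dots> \<longleftrightarrow> coann A (trace y) \<subseteq> G"
      using coann_subset unfolding G_def by auto
    also have "\<dots> \<longleftrightarrow> y \<in> coann H {f}"
      using True f join_eq_one_iff_trace[OF True f] by (simp add: H.mem_coann_iff trace_f)
    finally show ?thesis .
  qed (simp add: H.mem_coann_iff)
  then have "coann H X = coann H {f}"
    by (rule Set.set_eqI)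
  also have "\<dots> = principal_filter H e"
    using e f ef by (rule H.coann_complement_eq_principal_filter)
  finally have "coann H X = principal_filter H e" .
  moreover have "e \<in> boolean_center H"
    using e f ef by (auto simp: boolean_center_def)
  ultimately show "\<exists>e\<in>boolean_center H. coann H X = principal_filter H e"
    by blast
qed

end

theorem lemma4p8:
  fixes A :: "('a, 'b) reslat_scheme"
  assumes "residuated_lattice A"
  shows "residuated_lattice (strongly_co_Stone_hull A) \<and>
    strongly_co_Stone (strongly_co_Stone_hull A)"
proof -
  interpret co_Stone_hull A
    by (rule co_Stone_hull.intro[OF assms])
  show ?thesis
    using H.residuated_lattice_axioms strongly_co_Stone_H by blast
qed

end
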